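(* Let $X\subset\mathbb{P}^r$ be an irreducible non-degenerate projective variety, and let $k\ge 0$ and $s\geq 1$ be integers with $k\le s-1<r$. Then $X$ is $(k,s)$-identifiable if and only if the Segre variety $Seg(\mathbb{P}^k\times X)\subset\mathbb{P}^{rk+r+k}$ is $s$-identifiable.
   Context: Everything is over an algebraically closed field $K$ of characteristic $0$. Let $N=rk+r+k=(k+1)(r+1)-1$. The Segre variety $Seg(\mathbb{P}^k\times X)\subset\mathbb{P}^N$ is the image of the Segre embedding $\varphi:\mathbb{P}^k\times X\to\mathbb{P}^N$, $\varphi(\Lambda,P)=(\lambda_ix_j)_{0\le i\le k,\,0\le j\le r}$ for $\Lambda=(\lambda_0,\dots,\lambda_k)$ and $P=(x_0,\dots,x_r)$. Let $Y\subset\mathbb{P}^m$ be an irreducible non-degenerate projective variety. For integers $0\le k\le s-1\le m$, the $(k,s)$-Grassmann secant variety $GS_Y(k,s)$ is the Zariski closure in the Grassmannian $\mathbb{G}(k,m)$ (of $k$-dimensional linear subspaces of $\mathbb{P}^m$) of the set of those $\Lambda\in\mathbb{G}(k,m)$ that lie in the linear span of $s$ (linearly) independent points of $Y$. For $k=0$ it is the $s$-th secant variety $\sigma_s(Y)$. The $Y$-rank of a linear subspace $\Pi\subset\mathbb{P}^m$ is the minimum integer $s$ such that there exist $s$ distinct points $P_1,\dots,P_s\in Y$ with $\Pi\subset\langle P_1,\dots,P_s\rangle$. If $s$ is the $Y$-rank of $\Pi$, then $\Pi$ is called $Y$-identifiable if there is a unique set of $s$ distinct points $\{P_1,\dots,P_s\}\subset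 Y$ whose span contains $\Pi$. We say that $Y$ is $(k,s)$-identifiable (or that $(k,s)$-identifiability holds for $Y$) if the general element of $GS_Y(k,s)$ (i.e. every element outside some proper closed subvariety) has $Y$-rank equal to $s$ and is $Y$-identifiable. "$s$-identifiable" means $(0,s)$-identifiable. *)

theory Defs
  imports "HOL-Analysis.Analysis" "HOL-Library.Poly_Mapping"
begin

section \<open>Polynomials\<close>

text \<open>Polynomials in the variables \<open>'i\<close>, as finitely supported maps from monomials to coefficients.\<close>

type_synonym ('i, 'a) mpoly = "('i \<Rightarrow>\<^sub>0 nat) \<Rightarrow>\<^sub>0 'a"

definition mpoly_eval :: "('i, 'a::comm_ring_1) mpoly \<Rightarrow> ('i \<Rightarrow> 'a) \<Rightarrow> 'a" where
  "mpoly_eval f x =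
     (\<Sum>m\<in>Poly_Mapping.keys f. Poly_Mapping.lookup f m *
        (\<Prod>i\<in>Poly_Mapping.keys m. x i ^ Poly_Mapping.lookup m i))"

definition homogeneous :: "('i, 'a::comm_ring_1) mpoly \<Rightarrow> bool" where
  "homogeneous f \<longleftrightarrow>
     (\<exists>d. \<forall>m\<in>Poly_Mapping.keys f. (\<Sum>i\<in>Poly_Mapping.keys m. Poly_Mapping.lookup m i) = d)"


section \<open>Grassmannians and projective space\<close>

text \<open>
  The ambient space is the projectivization of \<open>'a ^ 'n\<close>, i.e. the projective space of dimension
  \<open>m = CARD('n) - 1\<close> with homogeneous coordinates indexed by \<open>'n\<close>. Projective linear subspaces are
  represented by the linear subspaces of \<open>'a ^ 'n\<close> of one dimension more; a point is thus a line
  through the origin, and the span of a set \<open>A\<close> of points is \<open>vec.span (\<Union>A)\<close>.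
\<close>

definition grassmannian :: "nat \<Rightarrow> ('a::field ^ 'n) set set" where
  "grassmannian k = {W. vec.subspace W \<and> vec.dim W = k + 1}"

abbreviation proj_space :: "('a::field ^ 'n) set set" where
  "proj_space \<equiv> grassmannian 0"

definition proj_closed :: "('a::field ^ 'n) set set \<Rightarrow> bool" where
  "proj_closed Z \<longleftrightarrow>
     (\<exists>F :: ('n, 'a) mpoly set. (\<forall>f\<in>F. homogeneous f) \<and>
        Z = {P \<in> proj_space. \<forall>f\<in>F. \<forall>x\<in>P. mpoly_eval f (\<lambda>i. x $ i) = 0})"

text \<open>
  The Pluecker coordinate with index \<open>J\<close> of \<open>v 0, \<dots>, v k\<close> is the determinant of the matrix with
  entries \<open>v i $ J j\<close> for \<open>i, j \<le> k\<close>. As \<open>'n\<close> carries no order, all \<open>J\<close> are admitted instead of the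
  increasing ones only: the coordinate depends only on \<open>J\<close> restricted to \<open>{..k}\<close>, is alternating in
  it, and so is \<open>0\<close> or, up to sign, one of the usual coordinates.
\<close>

definition pluecker :: "nat \<Rightarrow> (nat \<Rightarrow> 'a::field ^ 'n) \<Rightarrow> (nat \<Rightarrow> 'n) \<Rightarrow> 'a" where
  "pluecker k v J = (\<Sum>\<sigma> | \<sigma> permutes {..k}. of_int (sign \<sigma>) * (\<Prod>i\<le>k. v i $ J (\<sigma> i)))"

text \<open>The Zariski topology of the Grassmannian is the one induced by the Pluecker embedding.
  If \<open>W\<close> has dimension \<open>k + 1\<close> and is spanned by \<open>v ` {..k}\<close>, then \<open>v 0, \<dots>, v k\<close> is a basis of \<open>W\<close>.\<close>

definition grassmann_closed :: "nat \<Rightarrow> ('a::field ^ 'n) set set \<Rightarrow> bool" where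
  "grassmann_closed k Z \<longleftrightarrow>
     (\<exists>F :: (nat \<Rightarrow> 'n, 'a) mpoly set. (\<forall>f\<in>F. homogeneous f) \<and>
        Z = {W \<in> grassmannian k. \<forall>f\<in>F. \<forall>v. vec.span (v ` {..k}) = W \<longrightarrow>
                mpoly_eval f (pluecker k v) = 0})"

definition grassmann_closure :: "nat \<Rightarrow> ('a::field ^ 'n) set set \<Rightarrow> ('a ^ 'n) set set" where
  "grassmann_closure k S = \<Inter>{Z. grassmann_closed k Z \<and> S \<subseteq> Z}"


section \<open>Projective varieties and Segre varieties\<close>

definition irreducible_proj_variety :: "('a::field ^ 'n) set set \<Rightarrow> bool" where
  "irreducible_proj_variety X \<longleftrightarrow>
     proj_closed X \<and> X \<noteq> {} \<and>
     (\<forall>Z1 Z2. proj_closed Z1 \<and> proj_closed Z2 \<and> X = Z1 \<union> Z2 \<longrightarrow> X = Z1 \<or> X = Z2)"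

definition nondegenerate :: "('a::field ^ 'n) set set \<Rightarrow> bool" where
  "nondegenerate X \<longleftrightarrow> vec.span (\<Union>X) = UNIV"

text \<open>If \<open>\<Lambda>\<close> and \<open>P\<close> are the lines through \<open>l\<close> and \<open>x\<close>, then \<open>segre \<Lambda> P\<close> is the line through the vector
  with coordinates \<open>l $ i * x $ j\<close>.\<close>

definition segre :: "('a::field ^ 'm) set \<Rightarrow> ('a ^ 'n) set \<Rightarrow> ('a ^ ('m::finite \<times> 'n)) set" where
  "segre \<Lambda> P = {\<chi> ij. l $ fst ij * x $ snd ij | l x. l \<in> \<Lambda> \<and> x \<in> P}"

definition segre_variety :: "('a::field ^ 'n) set set \<Rightarrow> ('a ^ ('m::finite \<times> 'n)) set set" where
  "segre_variety X = {segre \<Lambda> P | \<Lambda> P. \<Lambda> \<in> proj_space \<and> P \<in> X}"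


section \<open>Grassmann secant varieties and identifiability\<close>

definition grassmann_secant :: "('a::field ^ 'n) set set \<Rightarrow> nat \<Rightarrow> nat \<Rightarrow> ('a ^ 'n) set set" where
  "grassmann_secant Y k s =
     grassmann_closure k
       {W \<in> grassmannian k. \<exists>A. A \<subseteq> Y \<and> finite A \<and> card A = s \<and>
          vec.dim (vec.span (\<Union>A)) = s \<and> W \<subseteq> vec.span (\<Union>A)}"

definition variety_rank :: "('a::field ^ 'n) set set \<Rightarrow> ('a ^ 'n) set \<Rightarrow> nat" where
  "variety_rank Y W =
     (LEAST s. \<exists>A. A \<subseteq> Y \<and> finite A \<and> card A = s \<and> W \<subseteq> vec.span (\<Union>A))"

definition subspace_identifiable :: "('a::field ^ 'n) set set \<Rightarrow> ('a ^ 'n) set \<Rightarrow> bool" where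
  "subspace_identifiable Y W \<longleftrightarrow>
     (\<exists>!A. A \<subseteq> Y \<and> finite A \<and> card A = variety_rank Y W \<and> W \<subseteq> vec.span (\<Union>A))"

definition grassmann_identifiable :: "('a::field ^ 'n) set set \<Rightarrow> nat \<Rightarrow> nat \<Rightarrow> bool" where
  "grassmann_identifiable Y k s \<longleftrightarrow>
     (\<exists>Z. grassmann_closed k Z \<and> Z \<subset> grassmann_secant Y k s \<and>
        (\<forall>W \<in> grassmann_secant Y k s - Z. variety_rank Y W = s \<and> subspace_identifiable Y W))"

abbreviation identifiable :: "('a::field ^ 'n) set set \<Rightarrow> nat \<Rightarrow> bool" where
  "identifiable Y s \<equiv> grassmann_identifiable Y 0 s"

end

theory Submission
  imports Defs "HOL-Computational_Algebra.Polynomial"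
begin

text \<open>
  A point \<open>T\<close> of the ambient space of the Segre variety is the line through a \<open>(k + 1) \<times> (r + 1)\<close>
  matrix \<open>M\<close>. Decomposing \<open>M\<close> as a sum of rank one matrices \<open>l \<otimes> x\<close> with \<open>x\<close> in \<open>X\<close> is the same as
  putting its row space \<open>W\<close> inside the span of the points \<open>x\<close>. The minimal number of points is
  therefore the same for \<open>T\<close> and \<open>W\<close>; points attaining it are linearly independent, so \<open>M\<close>
  determines the left factors \<open>l\<close>, and \<open>T\<close> is identifiable exactly when \<open>W\<close> is.

  It remains to compare general elements. On matrices of full rank, \<open>T\<close> lies in the secant variety
  exactly when \<open>W\<close> lies in the Grassmann secant variety, because closed conditions can be moved both
  ways: the Pluecker coordinates of \<open>W\<close> are minors of \<open>M\<close>, and conversely matrices with row space \<open>W\<close>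
  have entries that are linear in the Pluecker coordinates. Finally, since \<open>k + 1 \<le> s\<close>, a proper
  closed subset of the secant variety misses the line through some matrix of full rank.
\<close>

section \<open>Homogeneous polynomial functions\<close>

text \<open>Functions rather than formal polynomials: substituting minors or the points of a line
  then becomes plain composition. The degree is an index of the relation, since the zero function
  carries every degree.\<close>

inductive hom_poly :: "nat \<Rightarrow> (('i \<Rightarrow> 'a::comm_ring_1) \<Rightarrow> 'a) \<Rightarrow> bool" where
  zero: "hom_poly d (\<lambda>x. 0)"
| const: "hom_poly 0 (\<lambda>x. c)"
| var: "hom_poly 1 (\<lambda>x. x i)"
| add: "hom_poly d f \<Longrightarrow> hom_poly d g \<Longrightarrow> hom_poly d (\<lambda>x. f x + g x)"
| mult: "hom_poly d f \<Longrightarrow> hom_poly e g \<Longrightarrow> hom_poly (d + e) (\<lambda>x. f x * g x)"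

lemma hom_poly_cmult: "hom_poly d f \<Longrightarrow> hom_poly d (\<lambda>x. c * f x)"
  using hom_poly.mult[OF hom_poly.const, of d f c] by simp

lemma hom_poly_sum:
  "(\<And>a. a \<in> A \<Longrightarrow> hom_poly d (f a)) \<Longrightarrow> hom_poly d (\<lambda>x. \<Sum>a\<in>A. f a x)"
  by (induction A rule: infinite_finite_induct) (auto intro: hom_poly.zero hom_poly.add)

lemma hom_poly_prod:
  "(\<And>a. a \<in> A \<Longrightarrow> hom_poly (e a) (f a)) \<Longrightarrow> hom_poly (\<Sum>a\<in>A. e a) (\<lambda>x. \<Prod>a\<in>A. f a x)"
  by (induction A rule: infinite_finite_induct) (auto intro: hom_poly.const hom_poly.mult)

lemma hom_poly_power: "hom_poly d f \<Longrightarrow> hom_poly (n * d) (\<lambda>x. f x ^ n)"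
  by (induction n) (auto intro: hom_poly.const hom_poly.mult)

text \<open>Serves to read equations in Pluecker coordinates as equations in matrix entries, and
  back. In the product case the degrees match because
  \<open>(d + d') * e = d * e + d' * e\<close>.\<close>

lemma hom_poly_compose:
  assumes "hom_poly d f" "\<And>j. hom_poly e (h j)"
  shows "hom_poly (d * e) (\<lambda>x. f (\<lambda>j. h j x))"
  using assms(1)
proof induction
  case (mult d f d' g)
  then show ?case
    using hom_poly.mult[of "d * e" _ "d' * e"] by (simp add: distrib_right)
qed (use assms(2) in \<open>auto intro: hom_poly.intros\<close>)

lemma hom_poly_reindex: "hom_poly d f \<Longrightarrow> hom_poly d (\<lambda>x. f (\<lambda>j. x (h j)))"
  using hom_poly_compose[of d f 1 "\<lambda>j x. x (h j)"] by (simp add: hom_poly.var[simplified])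

lemma hom_poly_scale:
  assumes "hom_poly d f"
  shows "f (\<lambda>i. c * x i) = c ^ d * f x"
  using assms by induction (auto simp: algebra_simps power_add)

lemma hom_poly_line:
  assumes "hom_poly d f"
  obtains p where "\<And>\<tau>. poly p \<tau> = f (\<lambda>i. a i + \<tau> * b i)"
proof -
  have "\<exists>p. \<forall>\<tau>. poly p \<tau> = f (\<lambda>i. a i + \<tau> * b i)"
    using assms
  proof induction
    case (zero d)
    then show ?case by (intro exI[of _ 0]) simp
  next
    case (const c)
    then show ?case by (intro exI[of _ "[:c:]"]) simp
  next
    case (var i)
    then show ?case by (intro exI[of _ "[:a i, b i:]"]) simp
  next
    case (add d f g)
    then show ?case by (metis poly_add)
  next
    case (mult d f e g)
    then show ?case by (metis poly_mult)
  qed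
  then show ?thesis using that by blast
qed

text \<open>Restricted to the line through \<open>a\<close> and \<open>b\<close>, both functions are
  polynomials in one variable, nonzero because the first does not vanish at 0 and the second not at
  1. Their product is nonzero, and in characteristic 0 it cannot vanish at every \<tau>.\<close>

lemma hom_poly_common_nonzero:
  fixes f g :: "('i \<Rightarrow> 'a::{field, ring_char_0}) \<Rightarrow> 'a"
  assumes f: "hom_poly d f" "f a \<noteq> 0" and g: "hom_poly e g" "g b \<noteq> 0"
  obtains \<tau> where "f (\<lambda>i. a i + \<tau> * (b i - a i)) \<noteq> 0" "g (\<lambda>i. a i + \<tau> * (b i - a i)) \<noteq> 0"
proof -
  obtain p where p: "\<And>\<tau>. poly p \<tau> = f (\<lambda>i. a i + \<tau> * (b i - a i))"
    using hom_poly_line[OF f(1), where a = a and b = "\<lambda>i. b i - a i"] by blast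
  obtain q where q: "\<And>\<tau>. poly q \<tau> = g (\<lambda>i. a i + \<tau> * (b i - a i))"
    using hom_poly_line[OF g(1), where a = a and b = "\<lambda>i. b i - a i"] by blast
  have "poly p 0 \<noteq> 0" "poly q 1 \<noteq> 0"
    using f g by (simp_all add: p q)
  then have "p * q \<noteq> 0" by auto
  then obtain \<tau> where "poly (p * q) \<tau> \<noteq> 0"
    using poly_all_0_iff_0 by blast
  then show ?thesis
    using that[of \<tau>] by (simp flip: p q)
qed

section \<open>Evaluation and degree of formal polynomials\<close>

definition monom_eval :: "('i \<Rightarrow>\<^sub>0 nat) \<Rightarrow> ('i \<Rightarrow> 'a::comm_ring_1) \<Rightarrow> 'a" where
  "monom_eval m x = (\<Prod>i\<in>Poly_Mapping.keys m. x i ^ Poly_Mapping.lookup m i)"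

definition monom_degree :: "('i \<Rightarrow>\<^sub>0 nat) \<Rightarrow> nat" where
  "monom_degree m = (\<Sum>i\<in>Poly_Mapping.keys m. Poly_Mapping.lookup m i)"

text \<open>Provides a common index set for two monomials with different supports; the added factors
  have exponent 0.\<close>

lemma monom_eval_superset:
  assumes "finite S" "Poly_Mapping.keys m \<subseteq> S"
  shows "monom_eval m x = (\<Prod>i\<in>S. x i ^ Poly_Mapping.lookup m i)"
  unfolding monom_eval_def
  by (rule prod.mono_neutral_left) (use assms in \<open>auto simp: in_keys_iff\<close>)

lemma monom_degree_superset:
  assumes "finite S" "Poly_Mapping.keys m \<subseteq> S"
  shows "monom_degree m = (\<Sum>i\<in>S. Poly_Mapping.lookup m i)"
  unfolding monom_degree_def
  by (rule sum.mono_neutral_left) (use assms in \<open>auto simp: in_keys_iff\<close>)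

lemma monom_eval_add: "monom_eval (m + m') x = monom_eval m x * monom_eval m' x"
proof -
  let ?S = "Poly_Mapping.keys m \<union> Poly_Mapping.keys m'"
  have "monom_eval (m + m') x = (\<Prod>i\<in>?S. x i ^ Poly_Mapping.lookup (m + m') i)"
    by (rule monom_eval_superset) (simp_all add: Poly_Mapping.keys_add)
  also have "\<dots> = (\<Prod>i\<in>?S. x i ^ Poly_Mapping.lookup m i) * (\<Prod>i\<in>?S. x i ^ Poly_Mapping.lookup m' i)"
    by (simp add: lookup_add power_add prod.distrib)
  also have "\<dots> = monom_eval m x * monom_eval m' x"
    by (simp add: monom_eval_superset[of ?S])
  finally show ?thesis .
qed

lemma monom_degree_add: "monom_degree (m + m') = monom_degree m + monom_degree m'"
proof -
  let ?S = "Poly_Mapping.keys m \<union> Poly_Mapping.keys m'"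
  have "monom_degree (m + m') = (\<Sum>i\<in>?S. Poly_Mapping.lookup (m + m') i)"
    by (rule monom_degree_superset) (simp_all add: Poly_Mapping.keys_add)
  also have "\<dots> = monom_degree m + monom_degree m'"
    by (simp add: monom_degree_superset[of ?S] lookup_add sum.distrib)
  finally show ?thesis .
qed

lemma mpoly_eval_superset:
  assumes "finite S" "Poly_Mapping.keys f \<subseteq> S"
  shows "mpoly_eval f x = (\<Sum>m\<in>S. Poly_Mapping.lookup f m * monom_eval m x)"
  unfolding mpoly_eval_def monom_eval_def
  by (rule sum.mono_neutral_left) (use assms in \<open>auto simp: in_keys_iff\<close>)

lemma mpoly_eval_zero [simp]: "mpoly_eval 0 x = 0"
  by (simp add: mpoly_eval_def)

lemma mpoly_eval_single: "mpoly_eval (Poly_Mapping.single m c) x = c * monom_eval m x"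
  by (subst mpoly_eval_superset[of "{m}"]) (auto simp: lookup_single)

lemma mpoly_eval_add: "mpoly_eval (f + g) x = mpoly_eval f x + mpoly_eval g x"
proof -
  let ?S = "Poly_Mapping.keys f \<union> Poly_Mapping.keys g"
  have "mpoly_eval (f + g) x = (\<Sum>m\<in>?S. Poly_Mapping.lookup (f + g) m * monom_eval m x)"
    by (rule mpoly_eval_superset) (simp_all add: Poly_Mapping.keys_add)
  also have "\<dots> = mpoly_eval f x + mpoly_eval g x"
    by (simp add: mpoly_eval_superset[of ?S] lookup_add distrib_right sum.distrib)
  finally show ?thesis .
qed

lemma mpoly_eval_sum: "mpoly_eval (\<Sum>a\<in>A. f a) x = (\<Sum>a\<in>A. mpoly_eval (f a) x)"
  by (induction A rule: infinite_finite_induct) (auto simp: mpoly_eval_add)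

lemma mpoly_sum_singles:
  "(\<Sum>m\<in>Poly_Mapping.keys f. Poly_Mapping.single m (Poly_Mapping.lookup f m)) = f"
  by (intro poly_mapping_eqI) (auto simp: lookup_sum lookup_single when_def in_keys_iff)

text \<open>Both factors are split into single terms, for which exponents add and coefficients
  multiply; bilinearity does the rest.\<close>

lemma mpoly_eval_mult:
  fixes f g :: "('i, 'a::comm_ring_1) mpoly"
  shows "mpoly_eval (f * g) x = mpoly_eval f x * mpoly_eval g x"
proof -
  let ?s = "\<lambda>f m. Poly_Mapping.single m (Poly_Mapping.lookup f m)"
  have "f * g = (\<Sum>m\<in>Poly_Mapping.keys f. \<Sum>m'\<in>Poly_Mapping.keys g. ?s f m * ?s g m')"
    by (subst (1) mpoly_sum_singles[of f, symmetric], subst (1) mpoly_sum_singles[of g, symmetric])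
      (simp add: sum_product)
  then have "mpoly_eval (f * g) x =
      (\<Sum>m\<in>Poly_Mapping.keys f. \<Sum>m'\<in>Poly_Mapping.keys g. mpoly_eval (?s f m * ?s g m') x)"
    by (simp add: mpoly_eval_sum)
  also have "\<dots> = (\<Sum>m\<in>Poly_Mapping.keys f. \<Sum>m'\<in>Poly_Mapping.keys g.
      mpoly_eval (?s f m) x * mpoly_eval (?s g m') x)"
    by (simp add: mult_single mpoly_eval_single monom_eval_add mult_ac)
  also have "\<dots> = mpoly_eval (\<Sum>m\<in>Poly_Mapping.keys f. ?s f m) x *
      mpoly_eval (\<Sum>m\<in>Poly_Mapping.keys g. ?s g m) x"
    by (simp add: mpoly_eval_sum sum_product)
  finally show ?thesis
    by (simp add: mpoly_sum_singles)
qed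

text \<open>Closed sets are defined by formal equations; this lemma and
  \<open>hom_poly_mpoly_eval\<close> allow passing to functions and back.\<close>

lemma mpoly_eval_hom_poly:
  fixes f :: "('i, 'a::comm_ring_1) mpoly"
  assumes "homogeneous f"
  obtains d where "hom_poly d (mpoly_eval f)"
proof -
  obtain d where d: "\<And>m. m \<in> Poly_Mapping.keys f \<Longrightarrow> monom_degree m = d"
    using assms by (auto simp: homogeneous_def monom_degree_def)
  have mon: "hom_poly (monom_degree m) (\<lambda>x :: 'i \<Rightarrow> 'a. monom_eval m x)" for m
    unfolding monom_eval_def monom_degree_def
    using hom_poly_power[OF hom_poly.var] by (intro hom_poly_prod) fastforce
  have "hom_poly d (\<lambda>x. mpoly_eval f x)"
    unfolding mpoly_eval_def monom_eval_def[symmetric]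
    by (intro hom_poly_sum hom_poly_cmult) (use mon d in metis)
  then show ?thesis using that by simp
qed

lemma hom_poly_mpoly_eval:
  assumes "hom_poly d f"
  obtains g where "homogeneous g" "mpoly_eval g = f"
proof -
  \<comment> \<open>\<open>homogeneous\<close> only asserts that some common degree exists; the
    induction has to name it, since sums are formed of functions of equal degree.\<close>
  have "\<exists>g. (\<forall>m\<in>Poly_Mapping.keys g. monom_degree m = d) \<and> (\<forall>x. mpoly_eval g x = f x)"
    using assms
  proof induction
    case (zero d)
    then show ?case by (intro exI[of _ 0]) simp
  next
    case (const c)
    then show ?case
      by (intro exI[of _ "Poly_Mapping.single 0 c"])
        (simp add: mpoly_eval_single monom_eval_def monom_degree_def)
  next
    case (var i)
    then show ?case
      by (intro exI[of _ "Poly_Mapping.single (Poly_Mapping.single i 1) 1"])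
        (simp add: mpoly_eval_single monom_eval_def monom_degree_def)
  next
    case (add d f g)
    then obtain f' g' where
      "\<forall>m\<in>Poly_Mapping.keys f'. monom_degree m = d" "\<forall>x. mpoly_eval f' x = f x"
      "\<forall>m\<in>Poly_Mapping.keys g'. monom_degree m = d" "\<forall>x. mpoly_eval g' x = g x"
      by auto
    then show ?case
      using Poly_Mapping.keys_add[of f' g']
      by (intro exI[of _ "f' + g'"]) (auto simp: mpoly_eval_add)
  next
    case (mult d f e g)
    then obtain f' g' where
      "\<forall>m\<in>Poly_Mapping.keys f'. monom_degree m = d" "\<forall>x. mpoly_eval f' x = f x"
      "\<forall>m\<in>Poly_Mapping.keys g'. monom_degree m = e" "\<forall>x. mpoly_eval g' x = g x"
      by auto
    then show ?case
      using keys_mult[of f' g']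
      by (intro exI[of _ "f' * g'"]) (auto simp: mpoly_eval_mult monom_degree_add dest!: subsetD)
  qed
  then obtain g where "\<forall>m\<in>Poly_Mapping.keys g. monom_degree m = d" "\<And>x. mpoly_eval g x = f x"
    by blast
  then show ?thesis
    by (intro that[of g]) (auto simp: homogeneous_def monom_degree_def fun_eq_iff)
qed

section \<open>Matrices, row spaces and minors\<close>

text \<open>Coefficients sit on indices and not on vectors, so families with repetitions, such as
  the rows of a matrix, are covered.\<close>

lemma span_family:
  fixes u :: "'i \<Rightarrow> 'a::field ^ 'n"
  assumes "finite I"
  shows "w \<in> vec.span (u ` I) \<longleftrightarrow> (\<exists>c. w = (\<Sum>i\<in>I. c i *s u i))"
proof
  assume "w \<in> vec.span (u ` I)"
  then show "\<exists>c. w = (\<Sum>i\<in>I. c i *s u i)"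
  proof (induction rule: vec.span_induct_alt)
    case base
    show ?case by (intro exI[of _ "\<lambda>_. 0"]) simp
  next
    case (step b x y)
    then obtain i c where i: "i \<in> I" "x = u i" "y = (\<Sum>i\<in>I. c i *s u i)" by auto
    have "b *s x + y = (\<Sum>j\<in>I. ((if j = i then b else 0) + c j) *s u j)"
      using i assms by (simp add: vec.scale_left_distrib sum.distrib if_distrib[of "\<lambda>c. c *s _"] cong: if_cong)
    then show ?case by metis
  qed
next
  assume "\<exists>c. w = (\<Sum>i\<in>I. c i *s u i)"
  then show "w \<in> vec.span (u ` I)"
    by (auto intro!: vec.span_sum vec.span_scale intro: vec.span_base)
qed

text \<open>The dimension reaches \<open>card I\<close> only if \<open>u\<close> is injective on
  \<open>I\<close> with independent image. Conversely, a repetition \<open>u i = u j\<close> would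
  give the forbidden relation with coefficients 1 and -1.\<close>

lemma dim_family_eq_card_iff:
  fixes u :: "'i \<Rightarrow> 'a::field ^ 'n"
  assumes fin: "finite I"
  shows "vec.dim (vec.span (u ` I)) = card I \<longleftrightarrow>
         (\<forall>c. (\<Sum>i\<in>I. c i *s u i) = 0 \<longrightarrow> (\<forall>i\<in>I. c i = 0))"
proof
  assume dim: "vec.dim (vec.span (u ` I)) = card I"
  have "card (u ` I) \<le> card I" by (simp add: card_image_le fin)
  moreover have "vec.dim (vec.span (u ` I)) \<le> card (u ` I)"
    using fin by (intro vec.dim_le_card) auto
  ultimately have card: "card (u ` I) = card I" using dim by simp
  then have inj: "inj_on u I" by (simp add: fin eq_card_imp_inj_on)
  have ind: "vec.independent (u ` I)"
    by (rule vec.card_le_dim_spanning[of _ "vec.span (u ` I)"])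
      (use fin dim card in \<open>auto intro: vec.span_base\<close>)
  show "\<forall>c. (\<Sum>i\<in>I. c i *s u i) = 0 \<longrightarrow> (\<forall>i\<in>I. c i = 0)"
  proof (intro allI impI)
    fix c assume c: "(\<Sum>i\<in>I. c i *s u i) = 0"
    have "(\<Sum>v\<in>u ` I. c (the_inv_into I u v) *s v) = 0"
      using c by (simp add: sum.reindex[OF inj] the_inv_into_f_f[OF inj])
    with ind have "\<forall>v\<in>u ` I. c (the_inv_into I u v) = 0"
      unfolding vec.independent_explicit
      by (elim conjE allE[of _ "\<lambda>v. c (the_inv_into I u v)"]) simp
    then show "\<forall>i\<in>I. c i = 0" by (simp add: the_inv_into_f_f[OF inj])
  qed
next
  assume ind: "\<forall>c. (\<Sum>i\<in>I. c i *s u i) = 0 \<longrightarrow> (\<forall>i\<in>I. c i = 0)"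
  have inj: "inj_on u I"
  proof (rule inj_onI, rule ccontr)
    fix i j assume ij: "i \<in> I" "j \<in> I" "u i = u j" "i \<noteq> j"
    let ?c = "\<lambda>l. if l = i then 1 else if l = j then - 1 else 0 :: 'a"
    have "(\<Sum>l\<in>I. ?c l *s u l) = (\<Sum>l\<in>{i, j}. ?c l *s u l)"
      by (rule sum.mono_neutral_right) (use fin ij in auto)
    also have "\<dots> = 0" using ij by auto
    finally show False using ind[rule_format, of ?c i] ij by simp
  qed
  have "vec.independent (u ` I)"
    unfolding vec.independent_explicit
  proof (intro conjI allI impI)
    fix c assume "(\<Sum>v\<in>u ` I. c v *s v) = 0"
    then have "(\<Sum>i\<in>I. c (u i) *s u i) = 0" by (simp add: sum.reindex[OF inj])
    with ind[rule_format, of "\<lambda>i. c (u i)"] show "\<forall>v\<in>u ` I. c v = 0" by blast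
  qed (use fin in simp)
  then show "vec.dim (vec.span (u ` I)) = card I"
    by (simp add: vec.dim_span_eq_card_independent card_image[OF inj] del: vec.dim_span)
qed

section \<open>Row spaces, rank and minors of a matrix\<close>

definition rowspan :: "'a::field ^ 'n ^ 'm \<Rightarrow> ('a ^ 'n) set" where
  "rowspan M = vec.span (range (($) M))"

definition full_rank :: "'a::field ^ 'n ^ 'm \<Rightarrow> bool" where
  "full_rank M \<longleftrightarrow> vec.dim (rowspan M) = CARD('m)"

text \<open>As for \<open>pluecker\<close>, \<open>J\<close> may be any function; a repeated column
  makes the determinant 0. The row index type takes over the role of \<open>{..k}\<close>.\<close>

definition minor :: "'a::field ^ 'n ^ 'm \<Rightarrow> ('m \<Rightarrow> 'n) \<Rightarrow> 'a" where
  "minor M J = det (\<chi> a b. M $ a $ J b)"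

definition flat :: "'a ^ 'n ^ 'm \<Rightarrow> 'a ^ ('m::finite \<times> 'n)" where
  "flat M = (\<chi> p. M $ fst p $ snd p)"

lemma rowspan_subset_iff: "vec.subspace S \<Longrightarrow> rowspan M \<subseteq> S \<longleftrightarrow> (\<forall>i. M $ i \<in> S)"
  unfolding rowspan_def by (metis rangeI subset_eq vec.span_minimal vec.span_superset image_subset_iff)

lemma subspace_rowspan [simp]: "vec.subspace (rowspan M)"
  by (simp add: rowspan_def)

lemma row_in_rowspan: "M $ i \<in> rowspan M"
  by (simp add: rowspan_def vec.span_base)

lemma matrix_mult_row: "(N ** M) $ i = (\<Sum>k\<in>UNIV. N $ i $ k *s M $ k)"
  by (simp add: matrix_matrix_mult_def vec_eq_iff)

text \<open>The rows of \<open>N\<close> are the coefficients that express the rows of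
  \<open>M'\<close> through those of \<open>M\<close>.\<close>

lemma rowspan_subset_rowspan_iff:
  fixes M :: "'a::field ^ 'n ^ 'm" and M' :: "'a ^ 'n ^ 'k"
  shows "rowspan M' \<subseteq> rowspan M \<longleftrightarrow> (\<exists>N. M' = N ** M)"
proof
  assume "rowspan M' \<subseteq> rowspan M"
  then have "M' $ i \<in> vec.span (range (($) M))" for i
    using row_in_rowspan[of M' i] by (auto simp: rowspan_def)
  then have "\<exists>c. M' $ i = (\<Sum>k\<in>UNIV. c k *s M $ k)" for i
    by (subst (asm) span_family) auto
  then obtain c where "\<And>i. M' $ i = (\<Sum>k\<in>UNIV. c i k *s M $ k)" by metis
  then have "M' = (\<chi> i k. c i k) ** M"
    by (simp add: vec_eq_iff[of M'] matrix_mult_row)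
  then show "\<exists>N. M' = N ** M" by blast
next
  assume "\<exists>N. M' = N ** M"
  then show "rowspan M' \<subseteq> rowspan M"
    by (auto simp: rowspan_subset_iff matrix_mult_row intro!: vec.subspace_sum vec.subspace_scale row_in_rowspan)
qed

lemma dim_rowspan_le: "vec.dim (rowspan (M :: 'a::field ^ 'n ^ 'm)) \<le> CARD('m)"
proof -
  have "vec.dim (rowspan M) \<le> card (range (($) M))"
    unfolding rowspan_def by (intro vec.dim_le_card) auto
  also have "\<dots> \<le> CARD('m)" by (rule card_image_le) simp
  finally show ?thesis .
qed

lemma full_rank_rowspan_eq:
  fixes M :: "'a::field ^ 'n ^ 'm" and M' :: "'a ^ 'n ^ 'm"
  assumes "full_rank M'" "rowspan M' \<subseteq> rowspan M"
  shows "rowspan M' = rowspan M"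
  by (rule vec.subspace_dim_equal) (use assms dim_rowspan_le[of M] in \<open>auto simp: full_rank_def\<close>)

lemma full_rank_iff_right_invertible:
  fixes M :: "'a::field ^ 'n ^ 'm"
  shows "full_rank M \<longleftrightarrow> (\<exists>B::'a ^ 'm ^ 'n. M ** B = mat 1)"
proof -
  have "row i M = M $ i" for i by (simp add: row_def)
  then show ?thesis
    unfolding full_rank_def rowspan_def matrix_right_invertible_independent_rows
    using dim_family_eq_card_iff[of "UNIV :: 'm set" "($) M"] by simp
qed

text \<open>A right inverse of the square submatrix on the columns \<open>J\<close> becomes a right
  inverse of \<open>M\<close> once its rows are placed at the positions \<open>J\<close>.
  Conversely, at full rank the columns span the whole column space, so \<open>CARD('m)\<close> of
  them form a basis and have nonzero determinant.\<close>

lemma full_rank_iff_minor: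
  fixes M :: "'a::field ^ 'n ^ 'm"
  shows "full_rank M \<longleftrightarrow> (\<exists>J. minor M J \<noteq> 0)"
proof
  assume "\<exists>J. minor M J \<noteq> 0"
  then obtain J where "det (\<chi> a b. M $ a $ J b) \<noteq> 0" by (auto simp: minor_def)
  then obtain V where V: "(\<chi> a b. M $ a $ J b) ** V = mat 1"
    by (metis invertible_det_nz invertible_right_inverse)
  \<comment> \<open>Multiplication by this 0/1 matrix on the right selects the columns
    \<open>J\<close>.\<close>
  let ?P = "(\<chi> j b. if j = J b then 1 else 0) :: 'a ^ 'm ^ 'n"
  have "(\<chi> a b. M $ a $ J b) = M ** ?P"
    by (simp add: vec_eq_iff matrix_matrix_mult_def if_distrib cong: if_cong)
  with V have "M ** (?P ** V) = mat 1" by (simp add: matrix_mul_assoc)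
  then show "full_rank M" by (auto simp: full_rank_iff_right_invertible)
next
  assume "full_rank M"
  then obtain B :: "'a ^ 'm ^ 'n" where B: "M ** B = mat 1"
    by (auto simp: full_rank_iff_right_invertible)
  let ?u = "\<lambda>j. column j M"
  have span: "vec.span (columns M) = UNIV"
    using B matrix_right_invertible_span_columns by blast
  obtain B0 where B0: "B0 \<subseteq> columns M" "vec.independent B0" "columns M \<subseteq> vec.span B0"
    using vec.maximal_independent_subset by blast
  have B0_span: "vec.span B0 = UNIV"
    using span B0(3) by (metis top.extremum_uniqueI vec.span_minimal vec.subspace_span)
  have "finite B0" "card B0 = CARD('m)"
    using B0(2) B0_span vec.indep_card_eq_dim_span[of B0] by (simp_all add: card_cart_basis)
  then obtain g where g: "bij_betw g (UNIV :: 'm set) B0"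
    by (metis finite finite_same_card_bij)
  then have "\<forall>b. g b \<in> columns M"
    using B0(1) by (auto simp: bij_betw_def)
  then have "\<forall>b. \<exists>j. ?u j = g b"
    unfolding columns_def by simp metis
  then obtain J where J: "\<And>b. ?u (J b) = g b" by metis
  let ?V = "\<chi> a b. M $ a $ J b"
  have "column b ?V = g b" for b
    using J[of b] by (simp add: column_def)
  then have "columns ?V = B0"
    using g by (auto simp: columns_def bij_betw_def)
  then have "det ?V \<noteq> 0"
    using B0_span by (metis invertible_det_nz invertible_right_inverse matrix_right_invertible_span_columns)
  then show "\<exists>J. minor M J \<noteq> 0" by (auto simp: minor_def)
qed

text \<open>A change of basis multiplies all Pluecker coordinates by the same factor, so homogeneous
  equations in them do not depend on the basis.\<close>

lemma minor_mult: "minor (N ** M) J = det N * minor M J"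
proof -
  have "(\<chi> a b. (N ** M) $ a $ J b) = N ** (\<chi> a b. M $ a $ J b)"
    by (simp add: vec_eq_iff matrix_matrix_mult_def)
  then show ?thesis by (simp add: minor_def det_mul)
qed

lemma hom_poly_minor:
  fixes h :: "'m::finite \<Rightarrow> 'n::finite \<Rightarrow> ('i \<Rightarrow> 'a::field) \<Rightarrow> 'a"
  assumes "\<And>a b. hom_poly d (h a b)"
  shows "hom_poly (CARD('m) * d) (\<lambda>x. minor (\<chi> a b. h a b x) J)"
proof -
  have "hom_poly (\<Sum>a\<in>(UNIV :: 'm set). d) (\<lambda>x. \<Prod>a\<in>UNIV. h a (J (\<sigma> a)) x)" for \<sigma>
    by (intro hom_poly_prod assms)
  then show ?thesis
    unfolding minor_def det_def by (auto intro!: hom_poly_sum hom_poly_cmult)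
qed

text \<open>By Cramer's rule, \<open>minor M (J(a := j)) / minor M J\<close> is the entry with index \<open>(a, j)\<close> of
  \<open>V' ** M\<close>, where \<open>V'\<close> is the inverse of the submatrix of \<open>M\<close> on the columns \<open>J\<close>. So the rows of
  \<open>from_minors C J (minor M)\<close> lie in the row space of \<open>M\<close>, while the entries are linear in the minors.\<close>

definition from_minors :: "'a::field ^ 'm ^ 'm \<Rightarrow> ('m::finite \<Rightarrow> 'n) \<Rightarrow> (('m \<Rightarrow> 'n) \<Rightarrow> 'a) \<Rightarrow> 'a ^ 'n ^ 'm" where
  "from_minors C J p = (\<chi> i j. \<Sum>a\<in>UNIV. C $ i $ a * p (J(a := j)))"

lemma from_minors_minor:
  fixes M :: "'a::field ^ 'n ^ 'm"
  assumes V': "(\<chi> a b. M $ a $ J b) ** V' = mat 1"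
  shows "from_minors C J (minor M) = (\<chi> i j. minor M J * (C ** V') $ i $ j) ** M"
proof -
  let ?V = "\<chi> a b. M $ a $ J b"
  have det: "det ?V \<noteq> 0"
    using V' by (metis invertible_det_nz invertible_right_inverse)
  have "minor M (J(a := j)) = minor M J * (\<Sum>b\<in>UNIV. V' $ a $ b * M $ b $ j)" for a j
  proof -
    let ?u = "\<chi> b. M $ b $ j"
    \<comment> \<open>\<open>V' *v ?u\<close> solves the system with matrix \<open>?V\<close> and
      column \<open>j\<close> of \<open>M\<close> as right-hand side. Putting that side in place of
      column \<open>a\<close> of \<open>?V\<close>, as Cramer's rule asks, amounts to changing
      \<open>J\<close> to \<open>J(a := j)\<close>.\<close>
    have "?V *v (V' *v ?u) = ?u"
      by (simp add: matrix_vector_mul_assoc V')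
    then have "(V' *v ?u) $ a = det (\<chi> b c. if c = a then ?u $ b else ?V $ b $ c) / det ?V"
      using cramer[OF det] by simp
    also have "(\<chi> b c. if c = a then ?u $ b else ?V $ b $ c) = (\<chi> b c. M $ b $ (J(a := j)) c)"
      by (simp add: vec_eq_iff)
    finally show ?thesis
      using det by (simp add: minor_def matrix_vector_mult_def field_simps)
  qed
  then have "from_minors C J (minor M) $ i $ j =
      (\<Sum>a\<in>UNIV. \<Sum>b\<in>UNIV. minor M J * (C $ i $ a * V' $ a $ b) * M $ b $ j)" for i j
    by (simp add: from_minors_def sum_distrib_left mult_ac)
  also have "\<dots> i j = (\<Sum>b\<in>UNIV. \<Sum>a\<in>UNIV. minor M J * (C $ i $ a * V' $ a $ b) * M $ b $ j)" for i j
    by (rule sum.swap)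
  finally show ?thesis
    by (simp add: vec_eq_iff matrix_matrix_mult_def sum_distrib_left sum_distrib_right)
qed

text \<open>The submatrix on the columns \<open>J\<close>, divided by its determinant, cancels both
  the inverse \<open>V'\<close> and the factor \<open>minor M J\<close> produced by
  \<open>from_minors_minor\<close>. So every matrix with \<open>minor M J\<close> nonzero is reached
  from its own minors.\<close>

lemma from_minors_inverse:
  fixes M :: "'a::field ^ 'n ^ 'm"
  assumes "minor M J \<noteq> 0"
  shows "from_minors (\<chi> a b. M $ a $ J b / minor M J) J (minor M) = M"
proof -
  obtain V' where V': "(\<chi> a b. M $ a $ J b) ** V' = mat 1"
    using assms unfolding minor_def by (metis invertible_det_nz invertible_right_inverse)
  have "(\<chi> i j. minor M J * ((\<chi> a b. M $ a $ J b / minor M J) ** V') $ i $ j) = mat 1"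
    using assms by (simp add: V'[symmetric] vec_eq_iff matrix_matrix_mult_def sum_distrib_left)
  then show ?thesis
    using from_minors_minor[OF V'] by simp
qed

section \<open>Closed sets of subspaces and of tensors\<close>

text \<open>Transport along \<open>e\<close> turns the permutations of the row index type into those
  of \<open>{..k}\<close> and preserves the sign.\<close>

lemma pluecker_eq_minor:
  fixes v :: "nat \<Rightarrow> 'a::field ^ 'n" and e :: "'m::finite \<Rightarrow> nat"
  assumes e: "bij_betw e UNIV {..k}"
  shows "pluecker k v J = minor (\<chi> a. v (e a)) (J \<circ> e)"
proof -
  let ?P = "{\<pi>. \<pi> permutes (UNIV :: 'm set)}" and ?Q = "{\<sigma>. \<sigma> permutes {..k}}"
  have inj: "inj e" using e by (simp add: bij_betw_def)
  have "bij_betw (map_permutation UNIV e) ?P ?Q"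
  proof -
    have "map_permutation UNIV e =
        (\<lambda>\<pi> x. if x \<in> {..k} then e (\<pi> (inv_into UNIV e x)) else x)"
      using e by (auto simp: map_permutation_def restrict_id_def bij_betw_def fun_eq_iff)
    then show ?thesis using bij_betw_permutations[OF e] by simp
  qed
  then have "pluecker k v J = (\<Sum>\<pi>\<in>?P. of_int (sign (map_permutation UNIV e \<pi>)) *
      (\<Prod>i\<le>k. v i $ J (map_permutation UNIV e \<pi> i)))"
    unfolding pluecker_def by (rule sum.reindex_bij_betw[symmetric])
  also have "\<dots> = (\<Sum>\<pi>\<in>?P. of_int (sign \<pi>) * (\<Prod>a\<in>UNIV. v (e a) $ J (e (\<pi> a))))"
  proof (intro sum.cong refl)
    fix \<pi> :: "'m \<Rightarrow> 'm" assume "\<pi> \<in> ?P"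
    then have "sign (map_permutation UNIV e \<pi>) = sign \<pi>"
      using inj by (auto intro!: sign_map_permutation)
    moreover have "(\<Prod>i\<le>k. v i $ J (map_permutation UNIV e \<pi> i)) =
        (\<Prod>a\<in>UNIV. v (e a) $ J (map_permutation UNIV e \<pi> (e a)))"
      by (rule prod.reindex_bij_betw[OF e, symmetric])
    moreover have "map_permutation UNIV e \<pi> (e a) = e (\<pi> a)" for a
      using inj by (simp add: map_permutation_def restrict_id_def)
    ultimately show "of_int (sign (map_permutation UNIV e \<pi>)) *
        (\<Prod>i\<le>k. v i $ J (map_permutation UNIV e \<pi> i)) =
        of_int (sign \<pi>) * (\<Prod>a\<in>UNIV. v (e a) $ J (e (\<pi> a)))"
      by simp
  qed
  also have "\<dots> = minor (\<chi> a. v (e a)) (J \<circ> e)"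
    by (simp add: minor_def det_def)
  finally show ?thesis .
qed

text \<open>Brings in matrices whose rows are indexed by a type of size \<open>k + 1\<close>, so
  that determinants and matrix products become available. Coordinates are renamed along
  \<open>e\<close> one way and along \<open>inv e\<close> the other.\<close>

lemma grassmann_closed_iff_minor:
  fixes Z :: "('a::field ^ 'n) set set"
  assumes "CARD('m::finite) = k + 1"
  shows "grassmann_closed k Z \<longleftrightarrow>
    (\<exists>F :: ((('m \<Rightarrow> 'n) \<Rightarrow> 'a) \<Rightarrow> 'a) set. (\<forall>f\<in>F. \<exists>d. hom_poly d f) \<and>
       Z = {W \<in> grassmannian k. \<forall>f\<in>F. \<forall>M. rowspan M = W \<longrightarrow> f (minor M) = 0})"
proof -
  have "card (UNIV :: 'm set) = card {..k}" using assms by simp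
  then obtain e :: "'m \<Rightarrow> nat" where e: "bij_betw e UNIV {..k}"
    by (metis finite finite_atMost finite_same_card_bij)
  then have inj: "inj e" and img: "e ` UNIV = {..k}" by (auto simp: bij_betw_def)
  let ?mat = "\<lambda>v :: nat \<Rightarrow> 'a ^ 'n. \<chi> a. v (e a)"
  have rowspan: "rowspan (?mat v) = vec.span (v ` {..k})" for v
    by (simp add: rowspan_def flip: img) (simp add: image_image)
  \<comment> \<open>Only the values of \<open>v\<close> on \<open>{..k}\<close> matter, so spanning
    families and matrices are interchangeable.\<close>
  have bases: "(\<forall>v. vec.span (v ` {..k}) = W \<longrightarrow> Q (?mat v)) \<longleftrightarrow> (\<forall>M. rowspan M = W \<longrightarrow> Q M)" for W Q
  proof
    assume L: "\<forall>v. vec.span (v ` {..k}) = W \<longrightarrow> Q (?mat v)"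
    show "\<forall>M. rowspan M = W \<longrightarrow> Q M"
    proof (intro allI impI)
      fix M :: "'a ^ 'n ^ 'm" assume "rowspan M = W"
      moreover have "M = ?mat (\<lambda>i. M $ inv e i)" by (simp add: vec_eq_iff inj)
      ultimately show "Q M"
        using L[rule_format, of "\<lambda>i. M $ inv e i"] by (simp flip: rowspan)
    qed
  next
    assume R: "\<forall>M. rowspan M = W \<longrightarrow> Q M"
    show "\<forall>v. vec.span (v ` {..k}) = W \<longrightarrow> Q (?mat v)"
    proof (intro allI impI)
      fix v :: "nat \<Rightarrow> 'a ^ 'n" assume "vec.span (v ` {..k}) = W"
      then show "Q (?mat v)" using R[rule_format, of "?mat v"] by (simp only: rowspan)
    qed
  qed
  have pl: "pluecker k v = (\<lambda>J. minor (?mat v) (J \<circ> e))" for v :: "nat \<Rightarrow> 'a ^ 'n"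
    using pluecker_eq_minor[OF e] by blast
  show ?thesis
  proof
    assume "grassmann_closed k Z"
    then obtain F :: "(nat \<Rightarrow> 'n, 'a) mpoly set" where F: "\<forall>f\<in>F. homogeneous f" and
      Z: "Z = {W \<in> grassmannian k. \<forall>f\<in>F. \<forall>v. vec.span (v ` {..k}) = W \<longrightarrow> mpoly_eval f (pluecker k v) = 0}"
      unfolding grassmann_closed_def by blast
    let ?F = "(\<lambda>g y. mpoly_eval g (\<lambda>J. y (J \<circ> e))) ` F"
    have "\<forall>f\<in>?F. \<exists>d. hom_poly d f"
    proof
      fix f assume "f \<in> ?F"
      then obtain g where g: "g \<in> F" "f = (\<lambda>y. mpoly_eval g (\<lambda>J. y (J \<circ> e)))" by blast
      obtain d where "hom_poly d (mpoly_eval g)" using F g mpoly_eval_hom_poly by blast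
      then show "\<exists>d. hom_poly d f"
        using hom_poly_reindex[of d "mpoly_eval g" "\<lambda>J. J \<circ> e"] g by blast
    qed
    moreover have "Z = {W \<in> grassmannian k. \<forall>f\<in>?F. \<forall>M. rowspan M = W \<longrightarrow> f (minor M) = 0}"
      unfolding Z pl bases[of _ "\<lambda>M. mpoly_eval _ (\<lambda>J. minor M (J \<circ> e)) = 0"] by simp
    ultimately show "\<exists>F :: ((('m \<Rightarrow> 'n) \<Rightarrow> 'a) \<Rightarrow> 'a) set. (\<forall>f\<in>F. \<exists>d. hom_poly d f) \<and>
       Z = {W \<in> grassmannian k. \<forall>f\<in>F. \<forall>M. rowspan M = W \<longrightarrow> f (minor M) = 0}" by blast
  next
    assume "\<exists>F :: ((('m \<Rightarrow> 'n) \<Rightarrow> 'a) \<Rightarrow> 'a) set. (\<forall>f\<in>F. \<exists>d. hom_poly d f) \<and>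
       Z = {W \<in> grassmannian k. \<forall>f\<in>F. \<forall>M. rowspan M = W \<longrightarrow> f (minor M) = 0}"
    then obtain F :: "((('m \<Rightarrow> 'n) \<Rightarrow> 'a) \<Rightarrow> 'a) set" where F: "\<forall>f\<in>F. \<exists>d. hom_poly d f" and
      Z: "Z = {W \<in> grassmannian k. \<forall>f\<in>F. \<forall>M. rowspan M = W \<longrightarrow> f (minor M) = 0}" by blast
    let ?r = "\<lambda>(x :: (nat \<Rightarrow> 'n) \<Rightarrow> 'a) J. x (J \<circ> inv e)"
    have "\<exists>g. homogeneous g \<and> mpoly_eval g = (\<lambda>x. f (?r x))" if f: "f \<in> F" for f
    proof -
      obtain d where "hom_poly d f" using F f by blast
      from hom_poly_reindex[OF this, of "\<lambda>J. J \<circ> inv e"] show ?thesis using hom_poly_mpoly_eval by blast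
    qed
    then obtain G where G: "\<And>f. f \<in> F \<Longrightarrow> homogeneous (G f)"
      "\<And>f. f \<in> F \<Longrightarrow> mpoly_eval (G f) = (\<lambda>x. f (?r x))" by metis
    have "?r (pluecker k v) = minor (?mat v)" for v
      by (simp add: pl o_assoc[symmetric] inj)
    then have "Z = {W \<in> grassmannian k. \<forall>f\<in>G ` F. \<forall>v. vec.span (v ` {..k}) = W \<longrightarrow>
        mpoly_eval f (pluecker k v) = 0}"
      unfolding Z bases[symmetric] by (auto simp: G)
    then show "grassmann_closed k Z"
      unfolding grassmann_closed_def using G(1) by blast
  qed
qed

text \<open>For \<open>k = 0\<close> a Pluecker coordinate is a single entry of the spanning vector,
  and an index function counts only through its value at 0. Constant functions serve as
  representatives of the indices.\<close>

lemma grassmann_closed_0_iff: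
  fixes Z :: "('a::field ^ 'i) set set"
  shows "grassmann_closed 0 Z \<longleftrightarrow>
    (\<exists>F :: (('i \<Rightarrow> 'a) \<Rightarrow> 'a) set. (\<forall>f\<in>F. \<exists>d. hom_poly d f) \<and>
       Z = {T \<in> proj_space. \<forall>f\<in>F. \<forall>t. vec.span {t} = T \<longrightarrow> f (($) t) = 0})"
proof -
  have pl: "pluecker 0 v J = v 0 $ J 0" for v :: "nat \<Rightarrow> 'a ^ 'i" and J
    by (simp add: pluecker_def)
  have vecs: "(\<forall>v. vec.span (v ` {..0::nat}) = W \<longrightarrow> Q (v 0)) \<longleftrightarrow> (\<forall>t. vec.span {t} = W \<longrightarrow> Q t)"
    for W and Q :: "'a ^ 'i \<Rightarrow> bool"
    by (auto dest: spec[of _ "\<lambda>_. _"])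
  show ?thesis
  proof
    assume "grassmann_closed 0 Z"
    then obtain F :: "(nat \<Rightarrow> 'i, 'a) mpoly set" where F: "\<forall>f\<in>F. homogeneous f" and
      Z: "Z = {W \<in> proj_space. \<forall>f\<in>F. \<forall>v. vec.span (v ` {..0}) = W \<longrightarrow> mpoly_eval f (pluecker 0 v) = 0}"
      unfolding grassmann_closed_def by blast
    let ?F = "(\<lambda>g y. mpoly_eval g (\<lambda>J. y (J 0))) ` F"
    have "\<forall>f\<in>?F. \<exists>d. hom_poly d f"
    proof
      fix f assume "f \<in> ?F"
      then obtain g where g: "g \<in> F" "f = (\<lambda>y. mpoly_eval g (\<lambda>J. y (J 0)))" by blast
      obtain d where "hom_poly d (mpoly_eval g)" using F g mpoly_eval_hom_poly by blast
      then show "\<exists>d. hom_poly d f"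
        using hom_poly_reindex[of d "mpoly_eval g" "\<lambda>J. J 0"] g by blast
    qed
    moreover have "Z = {T \<in> proj_space. \<forall>f\<in>?F. \<forall>t. vec.span {t} = T \<longrightarrow> f (($) t) = 0}"
      unfolding Z pl[abs_def] vecs[of _ "\<lambda>t. mpoly_eval _ (\<lambda>J. t $ J 0) = 0"] by simp
    ultimately show "\<exists>F :: (('i \<Rightarrow> 'a) \<Rightarrow> 'a) set. (\<forall>f\<in>F. \<exists>d. hom_poly d f) \<and>
       Z = {T \<in> proj_space. \<forall>f\<in>F. \<forall>t. vec.span {t} = T \<longrightarrow> f (($) t) = 0}" by blast
  next
    assume "\<exists>F :: (('i \<Rightarrow> 'a) \<Rightarrow> 'a) set. (\<forall>f\<in>F. \<exists>d. hom_poly d f) \<and>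
       Z = {T \<in> proj_space. \<forall>f\<in>F. \<forall>t. vec.span {t} = T \<longrightarrow> f (($) t) = 0}"
    then obtain F :: "(('i \<Rightarrow> 'a) \<Rightarrow> 'a) set" where F: "\<forall>f\<in>F. \<exists>d. hom_poly d f" and
      Z: "Z = {T \<in> proj_space. \<forall>f\<in>F. \<forall>t. vec.span {t} = T \<longrightarrow> f (($) t) = 0}" by blast
    let ?r = "\<lambda>(x :: (nat \<Rightarrow> 'i) \<Rightarrow> 'a) i. x (\<lambda>_. i)"
    have "\<exists>g. homogeneous g \<and> mpoly_eval g = (\<lambda>x. f (?r x))" if f: "f \<in> F" for f
    proof -
      obtain d where "hom_poly d f" using F f by blast
      from hom_poly_reindex[OF this, of "\<lambda>i _. i"] show ?thesis using hom_poly_mpoly_eval by blast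
    qed
    then obtain G where G: "\<And>f. f \<in> F \<Longrightarrow> homogeneous (G f)"
      "\<And>f. f \<in> F \<Longrightarrow> mpoly_eval (G f) = (\<lambda>x. f (?r x))" by metis
    have "Z = {W \<in> proj_space. \<forall>f\<in>G ` F. \<forall>v. vec.span (v ` {..0}) = W \<longrightarrow>
        mpoly_eval f (pluecker 0 v) = 0}"
      unfolding Z vecs[symmetric] by (auto simp: G pl)
    then show "grassmann_closed 0 Z"
      unfolding grassmann_closed_def using G(1) by blast
  qed
qed

section \<open>Closed sets and closures in the Grassmannian\<close>

lemma grassmann_closed_subset: "grassmann_closed k Z \<Longrightarrow> Z \<subseteq> grassmannian k"
  by (auto simp: grassmann_closed_def)

lemma grassmann_closed_grassmannian: "grassmann_closed k (grassmannian k)"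
  unfolding grassmann_closed_def by (intro exI[of _ "{}"]) simp

text \<open>The defining equations are united. At least one set is required, as the empty
  intersection would be the whole type and not the Grassmannian.\<close>

lemma grassmann_closed_Inter:
  assumes "\<Z> \<noteq> {}" "\<And>Z. Z \<in> \<Z> \<Longrightarrow> grassmann_closed k Z"
  shows "grassmann_closed k (\<Inter>\<Z>)"
proof -
  let ?V = "\<lambda>F. {W \<in> grassmannian k. \<forall>f\<in>F. \<forall>v. vec.span (v ` {..k}) = W \<longrightarrow>
    mpoly_eval f (pluecker k v) = 0}"
  have "\<forall>Z\<in>\<Z>. \<exists>F. (\<forall>f\<in>F. homogeneous f) \<and> Z = ?V F"
    using assms(2) unfolding grassmann_closed_def by blast
  from bchoice[OF this] obtain F
    where F: "\<forall>Z\<in>\<Z>. (\<forall>f\<in>F Z. homogeneous f) \<and> Z = ?V (F Z)" ..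
  have "\<Inter>\<Z> = (\<Inter>Z\<in>\<Z>. ?V (F Z))"
    using INF_cong[OF refl, of \<Z> "\<lambda>Z. Z" "\<lambda>Z. ?V (F Z)"] F by simp
  also have "\<dots> = ?V (\<Union>Z\<in>\<Z>. F Z)" using assms(1) by auto
  finally have eq: "\<Inter>\<Z> = ?V (\<Union>Z\<in>\<Z>. F Z)" .
  show ?thesis
    unfolding grassmann_closed_def
  proof (intro exI conjI)
    show "\<forall>f\<in>(\<Union>Z\<in>\<Z>. F Z). homogeneous f" using F by blast
  qed (rule eq)
qed

lemma grassmann_closed_Int:
  assumes "grassmann_closed k Z" "grassmann_closed k Z'"
  shows "grassmann_closed k (Z \<inter> Z')"
proof -
  have "grassmann_closed k (\<Inter>{Z, Z'})"
    by (rule grassmann_closed_Inter) (use assms in auto)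
  then show ?thesis by simp
qed

lemma grassmann_closed_closure:
  assumes "S \<subseteq> grassmannian k"
  shows "grassmann_closed k (grassmann_closure k S)"
  unfolding grassmann_closure_def
  by (rule grassmann_closed_Inter) (use assms grassmann_closed_grassmannian in blast)+

lemma subset_grassmann_closure: "S \<subseteq> grassmann_closure k S"
  by (auto simp: grassmann_closure_def)

lemma grassmann_closure_least:
  "grassmann_closed k Z \<Longrightarrow> S \<subseteq> Z \<Longrightarrow> grassmann_closure k S \<subseteq> Z"
  by (auto simp: grassmann_closure_def)

section \<open>Points, their spanning vectors and flattened matrices\<close>

lemma flat_nth: "($) (flat M) = (\<lambda>p. M $ fst p $ snd p)"
  by (simp add: flat_def fun_eq_iff)

lemma flat_surj: obtains M where "t = flat M"
  by (rule that[of "\<chi> i j. t $ (i, j)"]) (simp add: flat_def vec_eq_iff)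

lemma flat_inject [simp]: "flat M = flat M' \<longleftrightarrow> M = M'"
  by (auto simp: flat_def vec_eq_iff)

lemma flat_eq_0_iff [simp]: "flat M = 0 \<longleftrightarrow> M = 0"
  by (auto simp: flat_def vec_eq_iff)

lemma full_rank_nonzero: "full_rank M \<Longrightarrow> M \<noteq> 0"
  by (auto simp: full_rank_def rowspan_def image_def)

lemma span_singleton_in_proj_space: "t \<noteq> 0 \<Longrightarrow> vec.span {t} \<in> proj_space"
  by (simp add: grassmannian_def vec.dim_span_eq_card_independent[of "{t}"] del: vec.dim_span)

lemma proj_space_eq_span:
  assumes "P \<in> proj_space" "x \<in> P" "x \<noteq> 0"
  shows "P = vec.span {x}"
proof (rule sym, rule vec.subspace_dim_equal)
  show "vec.span {x} \<subseteq> P"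
    using assms vec.span_minimal[of "{x}" P] by (auto simp: grassmannian_def)
  show "vec.dim P \<le> vec.dim (vec.span {x})"
    using assms(1) span_singleton_in_proj_space[OF assms(3)] unfolding grassmannian_def by simp
qed (use assms in \<open>auto simp: grassmannian_def\<close>)

lemma proj_spaceE:
  assumes "P \<in> proj_space"
  obtains x where "x \<noteq> 0" "P = vec.span {x}"
proof -
  have "\<not> P \<subseteq> {0}" using assms by (auto simp: grassmannian_def simp flip: vec.dim_eq_0)
  then obtain x where "x \<in> P" "x \<noteq> 0" by blast
  then show ?thesis using proj_space_eq_span[OF assms] that by blast
qed

text \<open>Proportional matrices have proportional rows, so the row space belongs to the point of
  the tensor space and not to its representative.\<close>

lemma rowspan_eq_of_span_flat_eq:
  fixes M M' :: "'a::field ^ 'n ^ 'm"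
  assumes "vec.span {flat M} = vec.span {flat M'}"
  shows "rowspan M = rowspan M'"
proof -
  have "rowspan M \<subseteq> rowspan M'" if "vec.span {flat M} = vec.span {flat M'}" for M M' :: "'a ^ 'n ^ 'm"
  proof -
    have "flat M \<in> vec.span {flat M'}" using that vec.span_base[of "flat M" "{flat M}"] by simp
    then obtain c where c: "flat M = c *s flat M'" by (auto simp: vec.span_singleton)
    have "M $ i = c *s M' $ i" for i
      using arg_cong[OF c, of "\<lambda>t. t $ (i, _)"] by (auto simp: flat_def vec_eq_iff)
    then show ?thesis
      by (auto simp: rowspan_subset_iff intro!: vec.subspace_scale row_in_rowspan)
  qed
  then show ?thesis using assms by blast
qed

lemma grassmannian_rowspanE:
  assumes "CARD('m::finite) = k + 1" "W \<in> grassmannian k"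
  obtains M :: "'a::field ^ 'n ^ 'm" where "full_rank M" "rowspan M = W"
proof -
  obtain B where B: "B \<subseteq> W" "vec.independent B" "W \<subseteq> vec.span B" "card B = vec.dim W"
    using vec.basis_exists by blast
  have W: "vec.subspace W" "card B = CARD('m)"
    using assms B by (auto simp: grassmannian_def)
  then have "finite B" using B(2) vec.indep_card_eq_dim_span by blast
  then obtain g where g: "bij_betw g (UNIV :: 'm set) B"
    using W(2) by (metis finite finite_same_card_bij)
  have "rowspan (\<chi> a. g a) = vec.span B"
    using g by (simp add: rowspan_def bij_betw_def)
  also have "\<dots> = W" using B W(1) by (metis subset_antisym vec.span_minimal)
  finally show ?thesis
    using that[of "\<chi> a. g a"] assms by (simp add: full_rank_def grassmannian_def)
qed

lemma rowspan_in_grassmannian_iff: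
  fixes M :: "'a::field ^ 'n ^ 'm"
  shows "CARD('m) = k + 1 \<Longrightarrow> rowspan M \<in> grassmannian k \<longleftrightarrow> full_rank M"
  by (simp add: grassmannian_def full_rank_def)

text \<open>An equation \<open>f\<close> of \<open>C\<close> is evaluated at the minors of
  \<open>M\<close>. The condition is void for matrices of lower rank; the extra factor, a minor,
  makes the equations hold there too, where a nonzero constant \<open>f\<close> would fail.\<close>

lemma closed_pullback_to_tensors:
  fixes C :: "('a::field ^ 'n) set set"
  assumes card: "CARD('m::finite) = k + 1" and C: "grassmann_closed k C"
  shows "grassmann_closed 0
    {T \<in> proj_space. \<forall>M :: 'a ^ 'n ^ 'm. T = vec.span {flat M} \<and> full_rank M \<longrightarrow> rowspan M \<in> C}"
    (is "grassmann_closed 0 ?D")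
proof -
  obtain F :: "((('m \<Rightarrow> 'n) \<Rightarrow> 'a) \<Rightarrow> 'a) set" where F: "\<forall>f\<in>F. \<exists>d. hom_poly d f" and
    C_eq: "C = {W \<in> grassmannian k. \<forall>f\<in>F. \<forall>M. rowspan M = W \<longrightarrow> f (minor M) = 0}"
    using C unfolding grassmann_closed_iff_minor[OF card] by blast
  let ?M = "\<lambda>x :: 'm \<times> 'n \<Rightarrow> 'a. \<chi> i j. x (i, j)"
  let ?G = "{\<lambda>x. minor (?M x) J * f (minor (?M x)) | J f. f \<in> F}"
  have hom: "\<exists>d. hom_poly d g" if "g \<in> ?G" for g
  proof -
    from that obtain J f where g: "f \<in> F" "g = (\<lambda>x. minor (?M x) J * f (minor (?M x)))" by blast
    obtain d where "hom_poly d f" using F g by blast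
    moreover have minor: "hom_poly (CARD('m) * 1) (\<lambda>x :: 'm \<times> 'n \<Rightarrow> 'a. minor (?M x) J)" for J
      by (rule hom_poly_minor) (rule hom_poly.var)
    ultimately have "hom_poly (d * (CARD('m) * 1)) (\<lambda>x :: 'm \<times> 'n \<Rightarrow> 'a. f (minor (?M x)))"
      by (rule hom_poly_compose)
    then show ?thesis using hom_poly.mult[OF minor] g by blast
  qed
  have M_flat: "?M (($) (flat M)) = M" for M by (simp add: flat_nth)
  have eq: "?D = {T \<in> proj_space. \<forall>g\<in>?G. \<forall>t. vec.span {t} = T \<longrightarrow> g (($) t) = 0}"
  proof (intro Collect_cong conj_cong refl iffI)
    fix T :: "('a ^ ('m \<times> 'n)) set"
    assume D: "\<forall>M :: 'a ^ 'n ^ 'm. T = vec.span {flat M} \<and> full_rank M \<longrightarrow> rowspan M \<in> C"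
    show "\<forall>g\<in>?G. \<forall>t. vec.span {t} = T \<longrightarrow> g (($) t) = 0"
    proof (intro ballI allI impI)
      fix g and t :: "'a ^ ('m \<times> 'n)" assume "g \<in> ?G" and T: "vec.span {t} = T"
      then obtain J f where g: "f \<in> F" "g = (\<lambda>x. minor (?M x) J * f (minor (?M x)))" by blast
      obtain M where t: "t = flat M" by (rule flat_surj)
      show "g (($) t) = 0"
      proof (cases "minor M J = 0")
        case False
        then have "rowspan M \<in> C" using D T t full_rank_iff_minor by blast
        then have "f (minor M) = 0" using g(1) by (auto simp: C_eq)
        then show ?thesis unfolding g t M_flat by simp
      qed (unfold g t M_flat, simp)
    qed
  next
    fix T :: "('a ^ ('m \<times> 'n)) set"
    assume G: "\<forall>g\<in>?G. \<forall>t. vec.span {t} = T \<longrightarrow> g (($) t) = 0"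
    show "\<forall>M :: 'a ^ 'n ^ 'm. T = vec.span {flat M} \<and> full_rank M \<longrightarrow> rowspan M \<in> C"
    proof (intro allI impI, elim conjE)
      fix M :: "'a ^ 'n ^ 'm" assume T: "T = vec.span {flat M}" and M: "full_rank M"
      obtain J where J: "minor M J \<noteq> 0" using M full_rank_iff_minor by blast
      have zero: "f (minor M) = 0" if "f \<in> F" for f
      proof -
        have "(\<lambda>x. minor (?M x) J * f (minor (?M x))) \<in> ?G" using that by blast
        from bspec[OF G this, rule_format, OF T[symmetric]]
        have "minor (?M (($) (flat M))) J * f (minor (?M (($) (flat M)))) = 0" .
        then show ?thesis unfolding M_flat using J by simp
      qed
      \<comment> \<open>Another matrix with the same row space is \<open>N ** M\<close>, so the
        value of \<open>f\<close> changes only by a power of \<open>det N\<close>.\<close>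
      have "f (minor M') = 0" if f: "f \<in> F" and M': "rowspan M' = rowspan M" for f and M' :: "'a ^ 'n ^ 'm"
      proof -
        obtain d where d: "hom_poly d f" using F f by blast
        obtain N where N: "M' = N ** M" using rowspan_subset_rowspan_iff[of M' M] M' by blast
        have "f (minor M') = f (\<lambda>J. det N * minor M J)"
          unfolding N minor_mult[abs_def] ..
        also have "\<dots> = det N ^ d * f (minor M)" by (rule hom_poly_scale[OF d])
        finally show ?thesis using zero[OF f] by simp
      qed
      then show "rowspan M \<in> C"
        using M by (auto simp: C_eq rowspan_in_grassmannian_iff[OF card])
    qed
  qed
  show ?thesis
    unfolding grassmann_closed_0_iff
  proof (intro exI conjI)
    show "\<forall>g\<in>?G. \<exists>d. hom_poly d g" using hom by blast
  qed (rule eq)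
qed

text \<open>The equations of \<open>D\<close> are to be tested at all matrices with row space
  \<open>W\<close>, but only the Pluecker coordinates of \<open>W\<close> are at hand.
  \<open>from_minors\<close> rebuilds such matrices from them with linear entries, and varying
  \<open>C\<close> and \<open>J\<close> reaches all of them.\<close>

lemma closed_pullback_to_subspaces:
  fixes D :: "('a::field ^ ('m::finite \<times> 'n::finite)) set set"
  assumes card: "CARD('m) = k + 1" and D: "grassmann_closed 0 D"
  shows "grassmann_closed k
    {W \<in> grassmannian k. \<forall>M :: 'a ^ 'n ^ 'm. rowspan M = W \<longrightarrow> vec.span {flat M} \<in> D}"
    (is "grassmann_closed k ?C")
proof -
  obtain F :: "(('m \<times> 'n \<Rightarrow> 'a) \<Rightarrow> 'a) set" where F: "\<forall>f\<in>F. \<exists>d. hom_poly d f" and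
    D_eq: "D = {T \<in> proj_space. \<forall>f\<in>F. \<forall>t. vec.span {t} = T \<longrightarrow> f (($) t) = 0}"
    using D unfolding grassmann_closed_0_iff by blast
  \<comment> \<open>Two guards: a nonzero \<open>p J\<close> puts the rows of the rebuilt matrix
    into \<open>W\<close>, and a nonzero minor on \<open>J'\<close> gives it full rank, so its row
    space is \<open>W\<close>. Otherwise the equation holds trivially.\<close>
  let ?g = "\<lambda>C J J' f p. p J * (minor (from_minors C J p) J' * f (($) (flat (from_minors C J p))))"
  let ?G = "{?g C J J' f | C J J' f. f \<in> F}"
  have hom: "\<exists>d. hom_poly d g" if "g \<in> ?G" for g
  proof -
    from that obtain C :: "'a ^ 'm ^ 'm" and J J' f where g: "f \<in> F" "g = ?g C J J' f"
      by (elim CollectE exE conjE) (rule that)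
    obtain d where d: "hom_poly d f" using F g by blast
    have entry: "hom_poly 1 (\<lambda>p. \<Sum>a\<in>UNIV. C $ i $ a * p (J(a := j)))" for i j
      by (intro hom_poly_sum hom_poly_cmult hom_poly.var)
    then have "hom_poly (CARD('m) * 1) (\<lambda>p. minor (from_minors C J p) J')"
      unfolding from_minors_def by (rule hom_poly_minor)
    moreover have "hom_poly (d * 1) (\<lambda>p. f (($) (flat (from_minors C J p))))"
      unfolding flat_nth from_minors_def using entry
      by (intro hom_poly_compose[OF d]) simp
    ultimately have "hom_poly (1 + (CARD('m) * 1 + d * 1)) (?g C J J' f)"
      by (intro hom_poly.mult hom_poly.var)
    then show ?thesis using g by blast
  qed
  have eq: "?C = {W \<in> grassmannian k. \<forall>g\<in>?G. \<forall>M. rowspan M = W \<longrightarrow> g (minor M) = 0}"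
  proof (intro Collect_cong conj_cong refl iffI)
    fix W :: "('a ^ 'n) set"
    assume C: "\<forall>M :: 'a ^ 'n ^ 'm. rowspan M = W \<longrightarrow> vec.span {flat M} \<in> D"
    show "\<forall>g\<in>?G. \<forall>M. rowspan M = W \<longrightarrow> g (minor M) = 0"
    proof (intro ballI allI impI)
      fix g and M :: "'a ^ 'n ^ 'm" assume "g \<in> ?G" and W: "rowspan M = W"
      then obtain C :: "'a ^ 'm ^ 'm" and J J' f where g: "f \<in> F" "g = ?g C J J' f"
      by (elim CollectE exE conjE) (rule that)
      let ?M = "from_minors C J (minor M)"
      have "f (($) (flat ?M)) = 0" if nz: "minor M J \<noteq> 0" "minor ?M J' \<noteq> 0"
      proof -
        obtain V' where "(\<chi> a b. M $ a $ J b) ** V' = mat 1"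
          using nz(1) unfolding minor_def by (metis invertible_det_nz invertible_right_inverse)
        from from_minors_minor[of M J V' C, OF this]
        have "rowspan ?M \<subseteq> rowspan M"
          unfolding rowspan_subset_rowspan_iff by (rule exI)
        moreover have "full_rank ?M" using full_rank_iff_minor[of ?M] nz(2) by blast
        ultimately have "rowspan ?M = rowspan M" by (intro full_rank_rowspan_eq)
        then have "vec.span {flat ?M} \<in> D" using C W by blast
        then show ?thesis using g(1) by (auto simp: D_eq)
      qed
      then show "g (minor M) = 0" unfolding g by auto
    qed
  next
    fix W :: "('a ^ 'n) set"
    assume W: "W \<in> grassmannian k"
      and G: "\<forall>g\<in>?G. \<forall>M. rowspan M = W \<longrightarrow> g (minor M) = 0"
    have zero: "f (($) (flat M)) = 0" if f: "f \<in> F" and M: "rowspan M = W" for f and M :: "'a ^ 'n ^ 'm"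
    proof -
      have "full_rank M" using W M rowspan_in_grassmannian_iff[OF card] by blast
      then obtain J where J: "minor M J \<noteq> 0" using full_rank_iff_minor by blast
      \<comment> \<open>With this choice the rebuilt matrix is \<open>M\<close> itself, and for
        \<open>J' = J\<close> both guards become \<open>minor M J\<close>.\<close>
      let ?C = "\<chi> a b. M $ a $ J b / minor M J"
      have "?g ?C J J f \<in> ?G" using f by blast
      from bspec[OF G this, rule_format, OF M] have "?g ?C J J f (minor M) = 0" .
      then show ?thesis using J unfolding from_minors_inverse[OF J] by simp
    qed
    show "\<forall>M :: 'a ^ 'n ^ 'm. rowspan M = W \<longrightarrow> vec.span {flat M} \<in> D"
    proof (intro allI impI)
      fix M :: "'a ^ 'n ^ 'm" assume M: "rowspan M = W"
      then have "full_rank M" using W rowspan_in_grassmannian_iff[OF card] by blast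
      then have "vec.span {flat M} \<in> proj_space"
        using full_rank_nonzero span_singleton_in_proj_space by (metis flat_eq_0_iff)
      moreover have "f (($) t) = 0" if "f \<in> F" "vec.span {t} = vec.span {flat M}" for f t
      proof -
        obtain M' where t: "t = flat M'" by (rule flat_surj)
        then have "rowspan M' = W" using that(2) M rowspan_eq_of_span_flat_eq by metis
        then show ?thesis using zero that(1) t by blast
      qed
      ultimately show "vec.span {flat M} \<in> D" by (simp add: D_eq)
    qed
  qed
  show ?thesis
    unfolding grassmann_closed_iff_minor[OF card]
  proof (intro exI conjI)
    show "\<forall>g\<in>?G. \<exists>d. hom_poly d g" using hom by blast
  qed (rule eq)
qed

section \<open>Decompositions of tensors and of their row spaces\<close>

definition spanning_set :: "('a::field ^ 'n) set set \<Rightarrow> ('a ^ 'n) set \<Rightarrow> ('a ^ 'n) set set \<Rightarrow> bool" where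
  "spanning_set Y W A \<longleftrightarrow> A \<subseteq> Y \<and> finite A \<and> W \<subseteq> vec.span (\<Union>A)"

text \<open>Trades \<open>LEAST\<close> for a lower bound on the sizes of spanning sets, which can
  be carried from \<open>X\<close> to the Segre variety; the existence part of
  \<open>\<exists>!\<close> shows that the bound is attained.\<close>

lemma rank_identifiable_iff:
  "variety_rank Y W = s \<and> subspace_identifiable Y W \<longleftrightarrow>
   (\<forall>A. spanning_set Y W A \<longrightarrow> s \<le> card A) \<and> (\<exists>!A. spanning_set Y W A \<and> card A = s)"
proof -
  have rank: "variety_rank Y W = (LEAST s. \<exists>A. spanning_set Y W A \<and> card A = s)"
    unfolding variety_rank_def spanning_set_def by (rule arg_cong[where f = Least]) auto
  have ident: "subspace_identifiable Y W \<longleftrightarrow> (\<exists>!A. spanning_set Y W A \<and> card A = variety_rank Y W)"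
    unfolding subspace_identifiable_def spanning_set_def by (rule arg_cong[where f = Ex1]) auto
  have min: "variety_rank Y W \<le> card A" if "spanning_set Y W A" for A
    unfolding rank by (rule Least_le) (use that in blast)
  show ?thesis
  proof
    assume "variety_rank Y W = s \<and> subspace_identifiable Y W"
    then have r: "variety_rank Y W = s" and i: "subspace_identifiable Y W" by simp_all
    show "(\<forall>A. spanning_set Y W A \<longrightarrow> s \<le> card A) \<and> (\<exists>!A. spanning_set Y W A \<and> card A = s)"
      using min[unfolded r] i[unfolded ident r] by (intro conjI allI impI)
  next
    assume R: "(\<forall>A. spanning_set Y W A \<longrightarrow> s \<le> card A) \<and> (\<exists>!A. spanning_set Y W A \<and> card A = s)"
    have r: "variety_rank Y W = s"
      unfolding rank
    proof (rule Least_equality)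
      show "\<exists>A. spanning_set Y W A \<and> card A = s" using conjunct2[OF R] by (rule ex1_implies_ex)
    qed (use R in auto)
    show "variety_rank Y W = s \<and> subspace_identifiable Y W"
      unfolding ident r using R by simp
  qed
qed

section \<open>Rank one tensors and points of the Segre variety\<close>

definition tensor :: "'a::field ^ 'm \<Rightarrow> 'a ^ 'n \<Rightarrow> 'a ^ ('m::finite \<times> 'n)" where
  "tensor l x = (\<chi> p. l $ fst p * x $ snd p)"

lemma tensor_scale: "tensor (c *s l) x = c *s tensor l x" "tensor l (c *s x) = c *s tensor l x"
  by (simp_all add: tensor_def vec_eq_iff mult_ac)

lemma segre_span: "segre (vec.span {l}) (vec.span {x}) = vec.span {tensor l x}"
proof (intro subset_antisym subsetI)
  fix t assume "t \<in> segre (vec.span {l}) (vec.span {x})"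
  then obtain a b where "t = tensor (a *s l) (b *s x)"
    by (auto simp: segre_def tensor_def vec.span_singleton)
  then have "t = (a * b) *s tensor l x" by (simp add: tensor_scale)
  then show "t \<in> vec.span {tensor l x}" by (simp add: vec.span_base vec.span_scale)
next
  fix t assume "t \<in> vec.span {tensor l x}"
  then obtain c where "t = tensor (c *s l) x"
    by (auto simp: vec.span_singleton tensor_scale)
  moreover have "c *s l \<in> vec.span {l}" "x \<in> vec.span {x}"
    by (simp_all add: vec.span_base vec.span_scale)
  ultimately show "t \<in> segre (vec.span {l}) (vec.span {x})"
    unfolding segre_def tensor_def by blast
qed

text \<open>Some coordinate \<open>l $ i\<close> is nonzero, and row \<open>i\<close> of the common
  tensor exhibits \<open>x\<close> as a multiple of \<open>x'\<close>.\<close>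

lemma segre_eqD:
  assumes "\<Lambda> \<in> proj_space" "\<Lambda>' \<in> proj_space" "P \<in> proj_space" "P' \<in> proj_space"
    and eq: "segre \<Lambda> P = segre \<Lambda>' P'"
  shows "P = P'"
proof -
  obtain l l' x x' where l: "l \<noteq> 0" "\<Lambda> = vec.span {l}" "l' \<noteq> 0" "\<Lambda>' = vec.span {l'}"
    and x: "x \<noteq> 0" "P = vec.span {x}" "x' \<noteq> 0" "P' = vec.span {x'}"
    using assms by (metis proj_spaceE)
  have "tensor l x \<in> vec.span {tensor l' x'}"
    using eq l x by (metis segre_span vec.span_base singletonI)
  then obtain c where c: "tensor l x = c *s tensor l' x'" by (auto simp: vec.span_singleton)
  obtain i where i: "l $ i \<noteq> 0" using l(1) by (auto simp: vec_eq_iff)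
  have "l $ i *s x = (c * l' $ i) *s x'"
    using arg_cong[OF c, of "\<lambda>t. t $ (i, _)"] by (auto simp: tensor_def vec_eq_iff mult_ac)
  then have "x = (c * l' $ i / l $ i) *s x'"
    using i by (simp add: vec_eq_iff field_simps)
  then have "x \<in> P'" unfolding x by (metis vec.span_base vec.span_scale singletonI)
  then show ?thesis using proj_space_eq_span[of P' x] assms x by simp
qed

lemma span_Union_lines:
  assumes "\<And>i. i \<in> I \<Longrightarrow> L i = vec.span {u i}"
  shows "vec.span (\<Union>(L ` I)) = vec.span (u ` I)"
proof (rule subset_antisym)
  show "vec.span (\<Union>(L ` I)) \<subseteq> vec.span (u ` I)"
    by (rule vec.span_minimal) (use assms in \<open>auto intro: subsetD[OF vec.span_mono, rotated]\<close>)
  show "vec.span (u ` I) \<subseteq> vec.span (\<Union>(L ` I))"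
    by (rule vec.span_mono) (use assms in \<open>auto intro: vec.span_base\<close>)
qed

text \<open>Fixes one spanning vector per point, so that linear combinations can be indexed by the
  points themselves.\<close>

definition gen :: "('a::field ^ 'n) set \<Rightarrow> 'a ^ 'n" where
  "gen P = (SOME x. x \<noteq> 0 \<and> P = vec.span {x})"

lemma span_gen:
  assumes "P \<in> proj_space"
  shows "vec.span {gen P} = P"
proof -
  have "\<exists>x. x \<noteq> 0 \<and> P = vec.span {x}" using assms by (blast elim: proj_spaceE)
  from someI_ex[OF this] show ?thesis unfolding gen_def by simp
qed

lemma gen_in: "P \<in> proj_space \<Longrightarrow> gen P \<in> P"
  using vec.span_base[of "gen P" "{gen P}"] by (simp add: span_gen)

lemma span_Union_points:
  assumes "A \<subseteq> proj_space"
  shows "vec.span (\<Union>A) = vec.span (gen ` A)"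
proof -
  have "vec.span (\<Union>(id ` A)) = vec.span (gen ` A)"
    by (rule span_Union_lines) (use assms in \<open>simp add: span_gen subset_iff\<close>)
  then show ?thesis by simp
qed

text \<open>The sum of the rank one matrices with left factors \<open>L x\<close> and right factors
  \<open>gen x\<close>, written row by row.\<close>

definition lin_comb :: "('a::field ^ 'n) set set \<Rightarrow> (('a ^ 'n) set \<Rightarrow> 'a ^ 'm) \<Rightarrow> 'a ^ 'n ^ 'm" where
  "lin_comb A L = (\<chi> i. \<Sum>x\<in>A. L x $ i *s gen x)"

lemma flat_lin_comb: "flat (lin_comb A L) = (\<Sum>x\<in>A. tensor (L x) (gen x))"
  by (simp add: flat_def lin_comb_def tensor_def vec_eq_iff sum_component)

lemma rowspan_lin_comb_subset:
  assumes "A \<subseteq> proj_space"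
  shows "rowspan (lin_comb A L) \<subseteq> vec.span (\<Union>A)"
  unfolding span_Union_points[OF assms]
  by (auto simp: rowspan_subset_iff lin_comb_def intro!: vec.span_sum vec.span_scale intro: vec.span_base)

text \<open>Row \<open>i\<close> of \<open>M\<close> has a coefficient at each point
  \<open>x\<close>; with \<open>x\<close> fixed and \<open>i\<close> varying, these form the left
  factor \<open>L x\<close>.\<close>

lemma lin_comb_of_rowspan_subset:
  fixes M :: "'a::field ^ 'n ^ 'm"
  assumes "A \<subseteq> proj_space" "finite A" "rowspan M \<subseteq> vec.span (\<Union>A)"
  obtains L where "M = lin_comb A L"
proof -
  have "M $ i \<in> vec.span (gen ` A)" for i
    using assms(3) row_in_rowspan[of M i] unfolding span_Union_points[OF assms(1)] by blast
  then have "\<exists>c. M $ i = (\<Sum>x\<in>A. c x *s gen x)" for i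
    by (simp add: span_family[OF assms(2)])
  then obtain c where "\<And>i. M $ i = (\<Sum>x\<in>A. c i x *s gen x)" by metis
  then show ?thesis
    by (intro that[of "\<lambda>x. \<chi> i. c i x"]) (simp add: lin_comb_def vec_eq_iff[of M])
qed

lemma segre_gen:
  assumes "x \<in> proj_space"
  shows "segre (vec.span {l}) x = vec.span {tensor l (gen x)}"
  using segre_span[of l "gen x"] by (simp add: span_gen[OF assms])

lemma span_segre_points:
  assumes "A \<subseteq> proj_space"
  shows "vec.span (\<Union>x\<in>A. segre (vec.span {L x}) x) = vec.span ((\<lambda>x. tensor (L x) (gen x)) ` A)"
  by (rule span_Union_lines) (use assms segre_gen in blast)

lemma flat_lin_comb_in_span:
  assumes "A \<subseteq> proj_space"
  shows "flat (lin_comb A L) \<in> vec.span (\<Union>x\<in>A. segre (vec.span {L x}) x)"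
  unfolding span_segre_points[OF assms] flat_lin_comb
  by (auto intro!: vec.span_sum intro: vec.span_base)

lemma lin_comb_of_flat_in_span:
  assumes "A \<subseteq> proj_space" "finite A"
    and "flat M \<in> vec.span (\<Union>x\<in>A. segre (vec.span {l x}) x)"
  obtains c where "M = lin_comb A (\<lambda>x. c x *s l x)"
proof -
  obtain c where "flat M = (\<Sum>x\<in>A. c x *s tensor (l x) (gen x))"
    using assms(3) unfolding span_segre_points[OF assms(1)] span_family[OF assms(2)] by blast
  then have "flat M = flat (lin_comb A (\<lambda>x. c x *s l x))"
    by (simp add: flat_lin_comb tensor_scale)
  then show ?thesis using that by simp
qed

lemma inj_on_segre:
  assumes "A \<subseteq> proj_space" "\<And>x. x \<in> A \<Longrightarrow> L x \<noteq> 0"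
  shows "inj_on (\<lambda>x. segre (vec.span {L x}) x) A"
proof (rule inj_onI)
  fix x y assume xy: "x \<in> A" "y \<in> A" and eq: "segre (vec.span {L x}) x = segre (vec.span {L y}) y"
  show "x = y"
    by (rule segre_eqD[OF _ _ _ _ eq]) (use xy assms in \<open>auto intro: span_singleton_in_proj_space\<close>)
qed

lemma segre_varietyE:
  assumes "B \<subseteq> segre_variety X" "X \<subseteq> proj_space"
  obtains l P where "\<And>b. b \<in> B \<Longrightarrow> l b \<noteq> 0" "\<And>b. b \<in> B \<Longrightarrow> P b \<in> X"
    "\<And>b. b \<in> B \<Longrightarrow> b = segre (vec.span {l b}) (P b)"
proof -
  have "\<forall>b\<in>B. \<exists>lP. fst lP \<noteq> 0 \<and> snd lP \<in> X \<and> b = segre (vec.span {fst lP}) (snd lP)"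
  proof
    fix b assume "b \<in> B"
    then obtain \<Lambda> P where b: "\<Lambda> \<in> proj_space" "P \<in> X" "b = segre \<Lambda> P"
      using assms(1) unfolding segre_variety_def by blast
    obtain l where "l \<noteq> 0" "\<Lambda> = vec.span {l}" using b(1) by (rule proj_spaceE)
    then show "\<exists>lP. fst lP \<noteq> 0 \<and> snd lP \<in> X \<and> b = segre (vec.span {fst lP}) (snd lP)"
      using b by (intro exI[of _ "(l, P)"]) simp
  qed
  from bchoice[OF this] obtain lP where
    "\<forall>b\<in>B. fst (lP b) \<noteq> 0 \<and> snd (lP b) \<in> X \<and> b = segre (vec.span {fst (lP b)}) (snd (lP b))" ..
  then show ?thesis by (intro that[of "fst \<circ> lP" "snd \<circ> lP"]) simp_all
qed

lemma segre_in_segre_variety: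
  "l \<noteq> 0 \<Longrightarrow> x \<in> X \<Longrightarrow> segre (vec.span {l}) x \<in> segre_variety X"
  unfolding segre_variety_def using span_singleton_in_proj_space by blast

text \<open>In an expansion of \<open>flat M\<close>, the part coming from \<open>b\<close> is a
  matrix whose rows are multiples of \<open>gen (P b)\<close>.\<close>

lemma rowspan_subset_of_segre_span:
  fixes M :: "'a::field ^ 'n ^ 'm"
  assumes X: "X \<subseteq> proj_space" and B: "finite B" "\<And>b. b \<in> B \<Longrightarrow> P b \<in> X"
    "\<And>b. b \<in> B \<Longrightarrow> b = segre (vec.span {l b}) (P b)"
    and M: "flat M \<in> vec.span (\<Union>B)"
  shows "rowspan M \<subseteq> vec.span (\<Union>(P ` B))"
proof -
  have P: "P b \<in> proj_space" if "b \<in> B" for b using X B(2) that by blast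
  have "b = vec.span {tensor (l b) (gen (P b))}" if "b \<in> B" for b
    by (rule trans[OF B(3)[OF that] segre_gen[OF P[OF that]]])
  then have span_B: "vec.span (\<Union>B) = vec.span ((\<lambda>b. tensor (l b) (gen (P b))) ` B)"
    using span_Union_lines[of B "\<lambda>b. b" "\<lambda>b. tensor (l b) (gen (P b))"] by simp
  then obtain c where c: "flat M = (\<Sum>b\<in>B. c b *s tensor (l b) (gen (P b)))"
    using M unfolding span_B span_family[OF B(1)] by blast
  have "M $ i = (\<Sum>b\<in>B. (c b * l b $ i) *s gen (P b))" for i
    using arg_cong[OF c, of "\<lambda>t. t $ (i, _)"]
    by (simp add: flat_def vec_eq_iff tensor_def sum_component mult_ac)
  moreover have "gen (P b) \<in> vec.span (\<Union>(P ` B))" if "b \<in> B" for b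
    using gen_in[OF P[OF that]] that by (intro vec.span_base) blast
  ultimately show ?thesis
    by (auto simp: rowspan_subset_iff intro!: vec.span_sum vec.span_scale)
qed

text \<open>Points of \<open>B\<close> are projected to their second factors. Several points may
  share a factor, hence only an inequality of sizes; equality makes the projection injective, and
  then \<open>B\<close> has exactly one point over each \<open>x\<close> in
  \<open>A\<close>.\<close>

lemma spanning_set_project:
  fixes M :: "'a::field ^ 'n ^ 'm"
  assumes X: "X \<subseteq> proj_space" and B: "spanning_set (segre_variety X) (vec.span {flat M}) B"
  obtains A where "spanning_set X (rowspan M) A" "card A \<le> card B"
    "card A = card B \<Longrightarrow> \<exists>l. (\<forall>x\<in>A. l x \<noteq> 0) \<and> B = (\<lambda>x. segre (vec.span {l x}) x) ` A"
proof -
  have sub: "B \<subseteq> segre_variety X" and fin: "finite B" and "flat M \<in> vec.span (\<Union>B)"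
    using B by (auto simp: spanning_set_def intro: vec.span_base)
  moreover obtain l P where lP: "\<And>b. b \<in> B \<Longrightarrow> l b \<noteq> 0" "\<And>b. b \<in> B \<Longrightarrow> P b \<in> X"
    "\<And>b. b \<in> B \<Longrightarrow> b = segre (vec.span {l b}) (P b)"
    using segre_varietyE[OF sub X] by metis
  ultimately have "rowspan M \<subseteq> vec.span (\<Union>(P ` B))"
    using rowspan_subset_of_segre_span[OF X] by metis
  then have span: "spanning_set X (rowspan M) (P ` B)"
    using lP(2) fin by (auto simp: spanning_set_def)
  have lift: "\<exists>l. (\<forall>x\<in>P ` B. l x \<noteq> 0) \<and> B = (\<lambda>x. segre (vec.span {l x}) x) ` P ` B"
    if "card (P ` B) = card B"
  proof -
    have inj: "inj_on P B" using that fin by (simp add: eq_card_imp_inj_on)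
    let ?l = "\<lambda>x. l (the_inv_into B P x)"
    have "(\<lambda>x. segre (vec.span {?l x}) x) ` P ` B = (\<lambda>b. b) ` B"
      unfolding image_image by (rule image_cong) (use inj lP(3) in \<open>simp_all add: the_inv_into_f_f\<close>)
    then show ?thesis
      using lP(1) inj by (intro exI[of _ ?l]) (auto simp: the_inv_into_f_f)
  qed
  show ?thesis
    by (rule that[OF span card_image_le[OF fin] lift])
qed

text \<open>Expanding the rows of \<open>M\<close> along \<open>A\<close> provides left factors. A
  left factor 0 gives no point of the Segre variety, so such points are dropped and only a subset
  \<open>A'\<close> is lifted.\<close>

lemma spanning_set_lift:
  fixes M :: "'a::field ^ 'n ^ 'm"
  assumes X: "X \<subseteq> proj_space" and A: "spanning_set X (rowspan M) A"
  obtains A' l where "A' \<subseteq> A" "\<And>x. x \<in> A' \<Longrightarrow> l x \<noteq> 0"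
    "spanning_set (segre_variety X) (vec.span {flat M}) ((\<lambda>x. segre (vec.span {l x}) x) ` A')"
    "card ((\<lambda>x. segre (vec.span {l x}) x) ` A') = card A'" "M = lin_comb A' l"
proof -
  have A_props: "A \<subseteq> X" "finite A" "A \<subseteq> proj_space" using A X by (auto simp: spanning_set_def)
  obtain L where L: "M = lin_comb A L"
    using lin_comb_of_rowspan_subset[OF A_props(3,2)] A unfolding spanning_set_def by blast
  let ?A = "{x \<in> A. L x \<noteq> 0}"
  have M: "M = lin_comb ?A L"
    unfolding L lin_comb_def vec_lambda_inject[OF UNIV_I UNIV_I] fun_eq_iff
    by (intro allI sum.mono_neutral_right) (use A_props in auto)
  have A': "?A \<subseteq> proj_space" using A_props by blast
  have "flat M \<in> vec.span (\<Union>x\<in>?A. segre (vec.span {L x}) x)"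
    unfolding M by (rule flat_lin_comb_in_span[OF A'])
  then have "vec.span {flat M} \<subseteq> vec.span (\<Union>x\<in>?A. segre (vec.span {L x}) x)"
    by (intro vec.span_minimal) auto
  moreover have "(\<lambda>x. segre (vec.span {L x}) x) ` ?A \<subseteq> segre_variety X"
    using A_props by (auto intro!: segre_in_segre_variety)
  ultimately have span: "spanning_set (segre_variety X) (vec.span {flat M})
      ((\<lambda>x. segre (vec.span {L x}) x) ` ?A)"
    using A_props by (simp add: spanning_set_def)
  have card: "card ((\<lambda>x. segre (vec.span {L x}) x) ` ?A) = card ?A"
    by (intro card_image inj_on_segre) (use A' in auto)
  show ?thesis
    by (rule that[OF _ _ span card M]) auto
qed

text \<open>A spanning set of minimal size is linearly independent, and each of its points is needed;
  so the tensor determines its left factors along it.\<close>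

lemma minimal_lin_comb_unique:
  fixes M :: "'a::field ^ 'n ^ 'm"
  assumes X: "X \<subseteq> proj_space" and A: "spanning_set X (rowspan M) A"
    and min: "\<And>A'. spanning_set X (rowspan M) A' \<Longrightarrow> card A \<le> card A'"
    and L: "M = lin_comb A L" and L': "M = lin_comb A L'" and x: "x \<in> A"
  shows "L x = L' x" "L x \<noteq> 0"
proof -
  have A_props: "A \<subseteq> X" "finite A" "A \<subseteq> proj_space" using A X by (auto simp: spanning_set_def)
  have not: "\<not> rowspan M \<subseteq> vec.span (\<Union>(A - {x}))"
  proof
    assume "rowspan M \<subseteq> vec.span (\<Union>(A - {x}))"
    then have "spanning_set X (rowspan M) (A - {x})"
      using A_props by (auto simp: spanning_set_def)
    from min[OF this] show False
      using x A_props(2) card_Diff1_less[of A x] by simp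
  qed
  have split: "lin_comb A L $ i = L x $ i *s gen x + lin_comb (A - {x}) L $ i" for L :: "_ \<Rightarrow> 'a ^ 'm" and i
    using A_props(2) x by (simp add: lin_comb_def sum.remove)
  show "L x \<noteq> 0"
  proof
    assume "L x = 0"
    then have "M = lin_comb (A - {x}) L" using split[of L] L by (simp add: vec_eq_iff[of M])
    then show False
      using not rowspan_lin_comb_subset[of "A - {x}" L] A_props by auto
  qed
  show "L x = L' x"
  proof (rule ccontr)
    assume "L x \<noteq> L' x"
    then obtain i where i: "L x $ i \<noteq> L' x $ i" by (auto simp: vec_eq_iff)
    let ?S = "vec.span (\<Union>(A - {x}))"
    have in_S: "lin_comb (A - {x}) L $ i \<in> ?S" for L :: "_ \<Rightarrow> 'a ^ 'm" and i
      using rowspan_lin_comb_subset[of "A - {x}" L] row_in_rowspan A_props(3) by blast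
    define d where "d = L x $ i - L' x $ i"
    have "d *s gen x = lin_comb (A - {x}) L' $ i - lin_comb (A - {x}) L $ i"
      using split[of L i] split[of L' i] L L' by (simp add: d_def algebra_simps)
    also have "\<dots> \<in> ?S" by (intro vec.span_diff in_S)
    finally have "(1 / d) *s (d *s gen x) \<in> ?S"
      by (rule vec.span_scale)
    moreover have "d \<noteq> 0" using i by (simp add: d_def)
    ultimately have gen_x: "gen x \<in> ?S" by simp
    have "M $ j \<in> ?S" for j
      unfolding L split[of L] by (intro vec.span_add vec.span_scale gen_x in_S)
    then show False using not by (simp add: rowspan_subset_iff)
  qed
qed

text \<open>Lower bounds on sizes pass through projecting and lifting. At the minimal size neither
  loses a point, so the spanning sets for the tensor are lifts of those for the row space. A lift
  determines its set by injectivity of the Segre embedding, and the set determines its lift because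
  the left factors are forced up to scalars.\<close>

lemma rank_identifiable_rowspan_iff:
  fixes M :: "'a::field ^ 'n ^ 'm"
  assumes X: "X \<subseteq> proj_space"
  shows "variety_rank X (rowspan M) = s \<and> subspace_identifiable X (rowspan M) \<longleftrightarrow>
    variety_rank (segre_variety X) (vec.span {flat M}) = s \<and>
    subspace_identifiable (segre_variety X) (vec.span {flat M})"
proof -
  let ?S = "spanning_set X (rowspan M)" and ?T = "spanning_set (segre_variety X) (vec.span {flat M})"
  let ?lift = "\<lambda>l A. (\<lambda>x. segre (vec.span {l x}) x) ` A"
  have fin: "finite A" "A \<subseteq> proj_space" if "?S A" for A
    using that X by (auto simp: spanning_set_def)
  have min_iff: "(\<forall>A. ?S A \<longrightarrow> s \<le> card A) \<longleftrightarrow> (\<forall>B. ?T B \<longrightarrow> s \<le> card B)"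
  proof (intro iffI allI impI)
    fix B assume min: "\<forall>A. ?S A \<longrightarrow> s \<le> card A" and B: "?T B"
    obtain A where A': "?S A" "card A \<le> card B"
      by (rule spanning_set_project[OF X B]) (rule that)
    with min show "s \<le> card B" by fastforce
  next
    fix A assume min: "\<forall>B. ?T B \<longrightarrow> s \<le> card B" and A: "?S A"
    obtain A' l where "A' \<subseteq> A" "?T (?lift l A')" "card (?lift l A') = card A'"
      by (rule spanning_set_lift[OF X A]) (rule that)
    with min have "s \<le> card A'" by fastforce
    also have "\<dots> \<le> card A" using \<open>A' \<subseteq> A\<close> fin(1)[OF A] by (rule card_mono[rotated])
    finally show "s \<le> card A" .
  qed
  have "(\<exists>!A. ?S A \<and> card A = s) \<longleftrightarrow> (\<exists>!B. ?T B \<and> card B = s)"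
    if min: "\<forall>A. ?S A \<longrightarrow> s \<le> card A"
  proof -
    have lift: "\<exists>l. (\<forall>x\<in>A. l x \<noteq> 0) \<and> ?T (?lift l A) \<and> card (?lift l A) = s"
      if A: "?S A" "card A = s" for A
    proof -
      obtain A' l where *: "A' \<subseteq> A" "\<And>x. x \<in> A' \<Longrightarrow> l x \<noteq> 0" "?T (?lift l A')"
        "card (?lift l A') = card A'"
        by (rule spanning_set_lift[OF X A(1)]) (rule that)
      have "s \<le> card (?lift l A')"
        using min[unfolded min_iff] *(3) by simp
      \<comment> \<open>A dropped point would contradict the lower bound.\<close>
      then have "A' = A"
        using A(2) *(1,4) fin(1)[OF A(1)] by (intro card_seteq) simp_all
      with * A(2) show ?thesis by (intro exI[of _ l]) simp
    qed
    have project: "\<exists>A l. ?S A \<and> card A = s \<and> (\<forall>x\<in>A. l x \<noteq> 0) \<and> B = ?lift l A"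
      if B: "?T B" "card B = s" for B
    proof -
      obtain A where A: "?S A" "card A \<le> card B"
        "card A = card B \<Longrightarrow> \<exists>l. (\<forall>x\<in>A. l x \<noteq> 0) \<and> B = ?lift l A"
        by (rule spanning_set_project[OF X B(1)]) (rule that)
      have card: "card A = card B" using min A(1,2) B(2) by (simp add: le_antisym)
      from A(3)[OF this] obtain l where "\<forall>x\<in>A. l x \<noteq> 0" "B = ?lift l A" by blast
      with A(1) card B(2) show ?thesis by (intro exI[of _ A] exI[of _ l]) simp
    qed
    have lift_eq: "A = A'"
      if "A \<subseteq> proj_space" "A' \<subseteq> proj_space" "\<forall>x\<in>A. l x \<noteq> 0" "\<forall>x\<in>A'. l' x \<noteq> 0"
        and eq: "?lift l A = ?lift l' A'" for A A' and l l' :: "_ \<Rightarrow> 'a ^ 'm"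
    proof -
      have "A \<subseteq> A'"
        if *: "A \<subseteq> proj_space" "A' \<subseteq> proj_space" "\<forall>x\<in>A. l x \<noteq> 0" "\<forall>x\<in>A'. l' x \<noteq> 0"
          "?lift l A = ?lift l' A'" for A A' and l l' :: "_ \<Rightarrow> 'a ^ 'm"
      proof
        fix x assume x: "x \<in> A"
        then have "segre (vec.span {l x}) x \<in> ?lift l' A'" using *(5) by blast
        then obtain y where y: "y \<in> A'" "segre (vec.span {l x}) x = segre (vec.span {l' y}) y"
          by blast
        have "x = y"
          by (rule segre_eqD[OF _ _ _ _ y(2)])
            (use x y(1) * in \<open>auto intro: span_singleton_in_proj_space\<close>)
        then show "x \<in> A'" using y by simp
      qed
      from this[of A A' l l'] this[of A' A l' l] that show ?thesis by simp
    qed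
    \<comment> \<open>Both lifts expand \<open>M\<close> along the minimal set \<open>A\<close>, so
      their scaled left factors coincide and are nonzero; hence the lines they span agree.\<close>
    have same_lift: "?lift l A = ?lift l' A"
      if A: "?S A" "card A = s" and l: "\<forall>x\<in>A. l x \<noteq> 0" "\<forall>x\<in>A. l' x \<noteq> 0"
        and T: "?T (?lift l A)" "?T (?lift l' A)" for A and l l' :: "_ \<Rightarrow> 'a ^ 'm"
    proof -
      have in_span: "flat M \<in> vec.span (\<Union>(?lift l A))" "flat M \<in> vec.span (\<Union>(?lift l' A))"
        using T unfolding spanning_set_def by (auto intro: vec.span_base)
      obtain c where c: "M = lin_comb A (\<lambda>x. c x *s l x)"
        by (rule lin_comb_of_flat_in_span[OF fin(2)[OF A(1)] fin(1)[OF A(1)] in_span(1)])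
      obtain c' where c': "M = lin_comb A (\<lambda>x. c' x *s l' x)"
        by (rule lin_comb_of_flat_in_span[OF fin(2)[OF A(1)] fin(1)[OF A(1)] in_span(2)])
      have "vec.span {l x} = vec.span {l' x}" if x: "x \<in> A" for x
      proof -
        have "c x *s l x = c' x *s l' x" "c x *s l x \<noteq> 0"
          using minimal_lin_comb_unique[OF X A(1) _ c c' x] min A(2) by simp_all
        moreover have "vec.span {v} = vec.span {a *s v}" if "v \<noteq> 0" "a *s v \<noteq> 0" for a and v :: "'a ^ 'm"
          by (rule proj_space_eq_span[OF span_singleton_in_proj_space[OF that(1)] _ that(2)])
            (simp add: vec.span_base vec.span_scale)
        ultimately show ?thesis using l x by metis
      qed
      then show ?thesis by (intro image_cong) auto
    qed
    show ?thesis
    proof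
      assume "\<exists>!A. ?S A \<and> card A = s"
      then obtain A where A': "?S A \<and> card A = s" and uniq: "\<forall>A'. ?S A' \<and> card A' = s \<longrightarrow> A' = A"
        by (elim ex1E) (rule that)
      from A' have A: "?S A" "card A = s" by simp_all
      obtain l where l: "\<forall>x\<in>A. l x \<noteq> 0" "?T (?lift l A)" "card (?lift l A) = s"
        using lift[OF A] by blast
      show "\<exists>!B. ?T B \<and> card B = s"
      proof (intro ex1I[of _ "?lift l A"] conjI l, elim conjE)
        fix B assume B: "?T B" "card B = s"
        obtain A' l' where *: "?S A'" "card A' = s" "\<forall>x\<in>A'. l' x \<noteq> 0" "B = ?lift l' A'"
          using project[OF B] by blast
        have "A' = A" by (rule uniq[rule_format]) (use * in simp)
        then show "B = ?lift l A"
          using same_lift[OF A, of l' l] l B(1) * by simp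
      qed
    next
      assume "\<exists>!B. ?T B \<and> card B = s"
      then obtain B where B': "?T B \<and> card B = s" and uniq: "\<forall>B'. ?T B' \<and> card B' = s \<longrightarrow> B' = B"
        by (elim ex1E) (rule that)
      from B' have B: "?T B" "card B = s" by simp_all
      obtain A l where A: "?S A" "card A = s" "\<forall>x\<in>A. l x \<noteq> 0" "B = ?lift l A"
        using project[OF B] by blast
      show "\<exists>!A. ?S A \<and> card A = s"
      proof (intro ex1I[of _ A] conjI A, elim conjE)
        fix A' assume A': "?S A'" "card A' = s"
        obtain l' where l': "\<forall>x\<in>A'. l' x \<noteq> 0" "?T (?lift l' A')" "card (?lift l' A') = s"
          using lift[OF A'] by blast
        have "?lift l' A' = ?lift l A" unfolding A(4)[symmetric] by (rule uniq[rule_format]) (use l' in simp)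
        then show "A' = A"
          by (rule lift_eq[OF fin(2)[OF A'(1)] fin(2)[OF A(1)] l'(1) A(3)])
      qed
    qed
  qed
  then show ?thesis
    unfolding rank_identifiable_iff using min_iff by (intro conj_cong) simp_all
qed

section \<open>Secant varieties\<close>

definition secant_subspaces :: "('a::field ^ 'n) set set \<Rightarrow> nat \<Rightarrow> nat \<Rightarrow> ('a ^ 'n) set set" where
  "secant_subspaces Y k s = {W \<in> grassmannian k. \<exists>A. A \<subseteq> Y \<and> finite A \<and> card A = s \<and>
     vec.dim (vec.span (\<Union>A)) = s \<and> W \<subseteq> vec.span (\<Union>A)}"

lemma grassmann_secant_eq: "grassmann_secant Y k s = grassmann_closure k (secant_subspaces Y k s)"
  by (simp add: grassmann_secant_def secant_subspaces_def)

lemma grassmann_closed_secant: "grassmann_closed k (grassmann_secant Y k s)"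
  unfolding grassmann_secant_eq
  by (rule grassmann_closed_closure) (auto simp: secant_subspaces_def)

lemma secant_subspaces_subset: "secant_subspaces Y k s \<subseteq> grassmann_secant Y k s"
  unfolding grassmann_secant_eq by (rule subset_grassmann_closure)

lemma grassmann_secant_least:
  "grassmann_closed k Z \<Longrightarrow> secant_subspaces Y k s \<subseteq> Z \<Longrightarrow> grassmann_secant Y k s \<subseteq> Z"
  unfolding grassmann_secant_eq by (rule grassmann_closure_least)

text \<open>Projection from the Segre variety may yield too few or dependent points. A basis of
  their span chosen among their generators is extended, by nondegeneracy, to a basis of the whole
  space consisting of generators of points of \<open>X\<close>, and then cut down to size
  \<open>s\<close>.\<close>

lemma extend_to_independent_points:
  fixes X :: "('a::field ^ 'n) set set"
  assumes X: "X \<subseteq> proj_space" "nondegenerate X" and A: "A \<subseteq> X" "finite A" "card A \<le> s"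
    and s: "s \<le> CARD('n)"
  obtains A' where "A' \<subseteq> X" "finite A'" "card A' = s" "vec.dim (vec.span (\<Union>A')) = s"
    "vec.span (\<Union>A) \<subseteq> vec.span (\<Union>A')"
proof -
  have AP: "A \<subseteq> proj_space" using A X by blast
  obtain B0 where B0: "B0 \<subseteq> gen ` A" "vec.independent B0" "gen ` A \<subseteq> vec.span B0"
    using vec.maximal_independent_subset by blast
  have "gen ` A \<subseteq> gen ` X" using A(1) by blast
  with B0(1) have "B0 \<subseteq> gen ` X" by (rule subset_trans)
  then obtain B1 where B1: "B0 \<subseteq> B1" "B1 \<subseteq> gen ` X" "vec.independent B1" "gen ` X \<subseteq> vec.span B1"
    using vec.maximal_independent_subset_extend[OF _ B0(2)] by metis
  have "vec.span (gen ` X) = UNIV"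
    using X span_Union_points[of X] by (simp add: nondegenerate_def)
  then have "vec.span B1 = UNIV"
    using B1(4) vec.span_minimal[of "gen ` X" "vec.span B1"] by (simp add: top.extremum_unique)
  then have card1: "finite B1" "card B1 = CARD('n)"
    using vec.indep_card_eq_dim_span[OF B1(3)] by (simp_all add: card_cart_basis)
  have "card B0 \<le> card (gen ` A)" by (rule card_mono) (use A(2) B0(1) in auto)
  also have "\<dots> \<le> card A" by (rule card_image_le[OF A(2)])
  finally have "card B0 \<le> s" using A(3) by simp
  then obtain B2 where B2: "B0 \<subseteq> B2" "B2 \<subseteq> B1" "card B2 = s"
    using exists_subset_between[of B0 s B1] B1(1) card1 s by auto
  have fin: "finite B2" using B2(2) card1(1) by (rule finite_subset)
  have ind: "vec.independent B2" using B1(3) B2(2) by (rule vec.independent_mono)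
  let ?A' = "(\<lambda>x. vec.span {x}) ` B2"
  have span: "vec.span (\<Union>?A') = vec.span B2"
    using span_Union_lines[of B2 "\<lambda>x. vec.span {x}" "\<lambda>x. x"] by simp
  have dim: "vec.dim (vec.span (\<Union>?A')) = s"
    unfolding span by (rule trans[OF vec.dim_span_eq_card_independent[OF ind] B2(3)])
  have sub: "?A' \<subseteq> X"
  proof
    fix P assume "P \<in> ?A'"
    then obtain x where x: "x \<in> B2" "P = vec.span {x}" by blast
    then obtain Q where Q: "Q \<in> X" "x = gen Q" using B2(2) B1(2) by blast
    then show "P \<in> X" using x(2) X(1) span_gen[of Q] by auto
  qed
  \<comment> \<open>Distinct basis vectors give distinct points: fewer than \<open>s\<close> points
    could not span dimension \<open>s\<close>.\<close>
  have "vec.dim (vec.span (\<Union>?A')) \<le> card (gen ` ?A')"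
    using span_Union_points[of ?A'] sub X(1) fin by (intro vec.dim_le_card) auto
  also have "\<dots> \<le> card ?A'" by (rule card_image_le) (use fin in simp)
  finally have "s \<le> card ?A'" using dim by simp
  moreover have "card ?A' \<le> s" using card_image_le[OF fin] B2(3) by metis
  ultimately have card: "card ?A' = s" by simp
  have "vec.span (gen ` A) \<subseteq> vec.span B2"
  proof (rule vec.span_minimal)
    show "gen ` A \<subseteq> vec.span B2" using B0(3) vec.span_mono[OF B2(1)] by blast
  qed simp
  then have "vec.span (\<Union>A) \<subseteq> vec.span (\<Union>?A')"
    unfolding span span_Union_points[OF AP] .
  then show ?thesis
    by (intro that[of ?A'] sub card dim) (use fin in simp)
qed

text \<open>Unlike in \<open>spanning_set_lift\<close>, exactly \<open>s\<close> independent points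
  are required, so none may be dropped. The lifted tensors are independent because each row of a
  relation between them is a relation between the independent \<open>gen x\<close>.\<close>

lemma secant_line_of_rowspan_subset:
  fixes M :: "'a::field ^ 'n ^ 'm"
  assumes X: "X \<subseteq> proj_space" and A: "A \<subseteq> X" "finite A" "card A = s" "vec.dim (vec.span (\<Union>A)) = s"
    and M: "rowspan M \<subseteq> vec.span (\<Union>A)" "M \<noteq> 0"
  shows "vec.span {flat M} \<in> secant_subspaces (segre_variety X) 0 s"
proof -
  have AP: "A \<subseteq> proj_space" using A X by blast
  obtain L where L: "M = lin_comb A L"
    by (rule lin_comb_of_rowspan_subset[OF AP A(2) M(1)])
  \<comment> \<open>A vanishing left factor is replaced by an arbitrary nonzero vector; the
    corresponding tensor gets coefficient 0 in \<open>M\<close>.\<close>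
  define L' where "L' x = (if L x = 0 then \<chi> i. 1 else L x)" for x
  have L'_nz: "L' x \<noteq> 0" for x by (simp add: L'_def vec_eq_iff)
  let ?u = "\<lambda>x. tensor (L' x) (gen x)"
  let ?B = "(\<lambda>x. segre (vec.span {L' x}) x) ` A"
  have inj: "inj_on (\<lambda>x. segre (vec.span {L' x}) x) A"
    by (rule inj_on_segre[OF AP L'_nz])
  have card: "card ?B = s" using card_image[OF inj] A(3) by simp
  have sub: "?B \<subseteq> segre_variety X"
    using A(1) L'_nz by (auto intro!: segre_in_segre_variety)
  have span: "vec.span (\<Union>?B) = vec.span (?u ` A)"
    by (rule span_segre_points[OF AP])
  have gens: "\<forall>c. (\<Sum>x\<in>A. c x *s gen x) = 0 \<longrightarrow> (\<forall>x\<in>A. c x = 0)"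
    using dim_family_eq_card_iff[OF A(2), of gen] A(3,4) span_Union_points[OF AP] by simp
  have "\<forall>c. (\<Sum>x\<in>A. c x *s ?u x) = 0 \<longrightarrow> (\<forall>x\<in>A. c x = 0)"
  proof (intro allI impI ballI)
    fix c x assume c: "(\<Sum>x\<in>A. c x *s ?u x) = 0" and x: "x \<in> A"
    have "flat (lin_comb A (\<lambda>x. c x *s L' x)) = 0"
      using c by (simp add: flat_lin_comb tensor_scale)
    then have "lin_comb A (\<lambda>x. c x *s L' x) $ i = 0" for i by simp
    then have sum_0: "(\<Sum>x\<in>A. (c x * L' x $ i) *s gen x) = 0" for i by (simp add: lin_comb_def)
    have "c x * L' x $ i = 0" for i by (rule gens[rule_format, OF sum_0 x])
    moreover obtain i where "L' x $ i \<noteq> 0" using L'_nz[of x] by (auto simp: vec_eq_iff)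
    ultimately show "c x = 0" by (metis mult_eq_0_iff)
  qed
  then have "vec.dim (vec.span (\<Union>?B)) = s"
    unfolding span using dim_family_eq_card_iff[OF A(2), of ?u] A(3) by simp
  moreover have "flat M \<in> vec.span (\<Union>?B)"
    unfolding span L flat_lin_comb
  proof (rule vec.span_sum)
    fix x assume x: "x \<in> A"
    show "tensor (L x) (gen x) \<in> vec.span (?u ` A)"
    proof (cases "L x = 0")
      case True
      then have "tensor (L x) (gen x) = 0" by (simp add: tensor_def vec_eq_iff)
      then show ?thesis by (simp add: vec.span_zero)
    next
      case False
      then have "tensor (L x) (gen x) = ?u x" by (simp add: L'_def)
      then show ?thesis using x by (simp add: vec.span_base)
    qed
  qed
  then have "vec.span {flat M} \<subseteq> vec.span (\<Union>?B)"
    by (intro vec.span_minimal) auto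
  moreover have "vec.span {flat M} \<in> proj_space"
    using M(2) by (intro span_singleton_in_proj_space) simp
  ultimately show ?thesis
    using sub card A(2) unfolding secant_subspaces_def by blast
qed

text \<open>Projection gives at most \<open>s\<close> points, which are then filled up to
  \<open>s\<close> independent ones.\<close>

lemma rowspan_subset_of_secant_line:
  fixes M :: "'a::field ^ 'n ^ 'm"
  assumes X: "X \<subseteq> proj_space" "nondegenerate X" and s: "s \<le> CARD('n)"
    and T: "vec.span {flat M} \<in> secant_subspaces (segre_variety X) 0 s"
  obtains A where "A \<subseteq> X" "finite A" "card A = s" "vec.dim (vec.span (\<Union>A)) = s"
    "rowspan M \<subseteq> vec.span (\<Union>A)"
proof -
  obtain B where B: "card B = s" "spanning_set (segre_variety X) (vec.span {flat M}) B"
    using T unfolding secant_subspaces_def spanning_set_def by blast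
  obtain A0 where A0: "spanning_set X (rowspan M) A0" "card A0 \<le> card B"
    by (rule spanning_set_project[OF X(1) B(2)]) (rule that)
  then have A0': "A0 \<subseteq> X" "finite A0" "rowspan M \<subseteq> vec.span (\<Union>A0)" "card A0 \<le> s"
    using B(1) by (simp_all add: spanning_set_def)
  obtain A where "A \<subseteq> X" "finite A" "card A = s" "vec.dim (vec.span (\<Union>A)) = s"
    "vec.span (\<Union>A0) \<subseteq> vec.span (\<Union>A)"
    by (rule extend_to_independent_points[OF X A0'(1,2,4) s])
  then show ?thesis by (intro that[of A] subset_trans[OF A0'(3)])
qed

text \<open>In each direction the pullback of one secant variety is closed and contains the set
  whose closure is the other one, so it contains that closure as well.\<close>

lemma secant_iff_full_rank:
  fixes M :: "'a::field ^ 'n ^ 'm"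
  assumes X: "X \<subseteq> proj_space" "nondegenerate X" and s: "s \<le> CARD('n)"
    and card: "CARD('m) = k + 1" and M: "full_rank M"
  shows "rowspan M \<in> grassmann_secant X k s \<longleftrightarrow>
    vec.span {flat M} \<in> grassmann_secant (segre_variety X) 0 s"
proof
  let ?D = "{T \<in> proj_space. \<forall>M :: 'a ^ 'n ^ 'm. T = vec.span {flat M} \<and> full_rank M \<longrightarrow>
    rowspan M \<in> grassmann_secant X k s}"
  assume T: "vec.span {flat M} \<in> grassmann_secant (segre_variety X) 0 s"
  have "grassmann_secant (segre_variety X) 0 s \<subseteq> ?D"
  proof (rule grassmann_secant_least[OF closed_pullback_to_tensors[OF card grassmann_closed_secant]], rule subsetI)
    fix T :: "('a ^ ('m \<times> 'n)) set" assume T: "T \<in> secant_subspaces (segre_variety X) 0 s"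
    have "rowspan M \<in> grassmann_secant X k s" if M: "T = vec.span {flat M}" "full_rank M" for M :: "'a ^ 'n ^ 'm"
    proof -
      obtain A where "A \<subseteq> X" "finite A" "card A = s" "vec.dim (vec.span (\<Union>A)) = s"
        "rowspan M \<subseteq> vec.span (\<Union>A)"
        by (rule rowspan_subset_of_secant_line[OF X s T[unfolded M(1)]])
      then have "rowspan M \<in> secant_subspaces X k s"
        unfolding secant_subspaces_def using M(2) rowspan_in_grassmannian_iff[OF card] by blast
      then show ?thesis using secant_subspaces_subset by blast
    qed
    moreover have "T \<in> proj_space" using T by (simp add: secant_subspaces_def)
    ultimately show "T \<in> ?D" by simp
  qed
  with T have "vec.span {flat M} \<in> ?D" by (rule subsetD[rotated])
  then show "rowspan M \<in> grassmann_secant X k s" using M by simp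
next
  let ?C = "{W \<in> grassmannian k. \<forall>M :: 'a ^ 'n ^ 'm. rowspan M = W \<longrightarrow>
    vec.span {flat M} \<in> grassmann_secant (segre_variety X) 0 s}"
  assume W: "rowspan M \<in> grassmann_secant X k s"
  have "grassmann_secant X k s \<subseteq> ?C"
  proof (rule grassmann_secant_least[OF closed_pullback_to_subspaces[OF card grassmann_closed_secant]], rule subsetI)
    fix W assume "W \<in> secant_subspaces X k s"
    then obtain A where W: "W \<in> grassmannian k" and A: "A \<subseteq> X" "finite A" "card A = s"
      "vec.dim (vec.span (\<Union>A)) = s" "W \<subseteq> vec.span (\<Union>A)"
      unfolding secant_subspaces_def by blast
    have "vec.span {flat M} \<in> grassmann_secant (segre_variety X) 0 s" if M: "rowspan M = W" for M :: "'a ^ 'n ^ 'm"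
    proof -
      have "full_rank M" using M W rowspan_in_grassmannian_iff[OF card] by blast
      then have "vec.span {flat M} \<in> secant_subspaces (segre_variety X) 0 s"
        using secant_line_of_rowspan_subset[OF X(1) A(1-4)] A(5) M full_rank_nonzero by blast
      then show ?thesis using secant_subspaces_subset by blast
    qed
    with W show "W \<in> ?C" by simp
  qed
  with W have "rowspan M \<in> ?C" by (rule subsetD[rotated])
  then show "vec.span {flat M} \<in> grassmann_secant (segre_variety X) 0 s" by simp
qed

text \<open>Applied to the span of \<open>s\<close> independent points; this is where
  \<open>k + 1 \<le> s\<close> enters.\<close>

lemma full_rank_in_subspace:
  assumes "vec.subspace S" "CARD('m::finite) \<le> vec.dim S"
  obtains M :: "'a::field ^ 'n ^ 'm" where "full_rank M" "rowspan M \<subseteq> S"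
proof -
  obtain B where B: "B \<subseteq> S" "vec.independent B" "card B = vec.dim S"
    by (rule vec.basis_exists[of S]) (rule that)
  obtain B' where B': "B' \<subseteq> B" "card B' = CARD('m)"
    using obtain_subset_with_card_n[of "CARD('m)" B] B(3) assms(2) by metis
  have ind: "vec.independent B'" using B(2) B'(1) by (rule vec.independent_mono)
  then have "finite B'" by (rule vec.finiteI_independent)
  then obtain g where g: "bij_betw g (UNIV :: 'm set) B'"
    using B'(2) by (metis finite finite_same_card_bij)
  have rowspan: "rowspan (\<chi> a. g a) = vec.span B'"
    using g by (simp add: rowspan_def bij_betw_def)
  have "full_rank (\<chi> a. g a)"
    unfolding full_rank_def rowspan using vec.dim_span_eq_card_independent[OF ind] B'(2) by simp
  moreover have "rowspan (\<chi> a. g a) \<subseteq> S"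
    unfolding rowspan using B'(1) B(1) assms(1) by (intro vec.span_minimal) auto
  ultimately show ?thesis by (rule that)
qed

text \<open>The witness lies on a line in the linear space of matrices whose rows lie in the span of \<open>s\<close>
  fixed points, a line that passes through both a matrix outside \<open>D\<close> and one of full rank.\<close>

lemma full_rank_secant_outside_closed:
  fixes X :: "('a::{field, ring_char_0} ^ 'n) set set" and D :: "('a ^ ('m::finite \<times> 'n)) set set"
  assumes X: "X \<subseteq> proj_space" "nondegenerate X" and s: "s \<le> CARD('n)" "CARD('m) \<le> s"
    and D: "grassmann_closed 0 D" and T: "T \<in> secant_subspaces (segre_variety X) 0 s" "T \<notin> D"
  obtains M :: "'a ^ 'n ^ 'm" where "full_rank M" "vec.span {flat M} \<notin> D"
    "vec.span {flat M} \<in> grassmann_secant (segre_variety X) 0 s"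
proof -
  obtain F :: "(('m \<times> 'n \<Rightarrow> 'a) \<Rightarrow> 'a) set" where F: "\<forall>f\<in>F. \<exists>d. hom_poly d f" and
    D_eq: "D = {T \<in> proj_space. \<forall>f\<in>F. \<forall>t. vec.span {t} = T \<longrightarrow> f (($) t) = 0}"
    using D unfolding grassmann_closed_0_iff by blast
  have "T \<in> proj_space" using T(1) by (simp add: secant_subspaces_def)
  with T(2) obtain f t where f: "f \<in> F" and t: "vec.span {t} = T" "f (($) t) \<noteq> 0"
    unfolding D_eq by blast
  obtain d where d: "hom_poly d f" using F f by blast
  obtain M0 :: "'a ^ 'n ^ 'm" where M0: "t = flat M0" by (rule flat_surj)
  obtain A where A: "A \<subseteq> X" "finite A" "card A = s" "vec.dim (vec.span (\<Union>A)) = s"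
    and M0_sub: "rowspan M0 \<subseteq> vec.span (\<Union>A)"
    by (rule rowspan_subset_of_secant_line[OF X s(1) T(1)[folded t(1), unfolded M0]])
  obtain M1 :: "'a ^ 'n ^ 'm" where M1: "full_rank M1" "rowspan M1 \<subseteq> vec.span (\<Union>A)"
    by (rule full_rank_in_subspace[of "vec.span (\<Union>A)"]) (use A(4) s(2) in auto)
  obtain J where J: "minor M1 J \<noteq> 0" using M1(1) full_rank_iff_minor[of M1] by blast
  let ?M = "\<lambda>x :: 'm \<times> 'n \<Rightarrow> 'a. \<chi> i j. x (i, j)"
  have M_flat: "?M (($) (flat M)) = M" for M by (simp add: flat_nth)
  have minor: "hom_poly (CARD('m) * 1) (\<lambda>x :: 'm \<times> 'n \<Rightarrow> 'a. minor (?M x) J)"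
    by (rule hom_poly_minor) (rule hom_poly.var)
  have f0: "f (($) (flat M0)) \<noteq> 0" using t(2) M0 by simp
  have J1: "minor (?M (($) (flat M1))) J \<noteq> 0" unfolding M_flat by (rule J)
  \<comment> \<open>An equation of \<open>D\<close> is nonzero at \<open>M0\<close> and a minor is
    nonzero at \<open>M1\<close>, so some point of the line through the two has both
    properties.\<close>
  obtain \<tau> where \<tau>:
    "f (\<lambda>p. flat M0 $ p + \<tau> * (flat M1 $ p - flat M0 $ p)) \<noteq> 0"
    "minor (?M (\<lambda>p. flat M0 $ p + \<tau> * (flat M1 $ p - flat M0 $ p))) J \<noteq> 0"
    by (rule hom_poly_common_nonzero[where a = "($) (flat M0)" and b = "($) (flat M1)", OF d f0 minor J1])
  define M where "M = ?M (\<lambda>p. flat M0 $ p + \<tau> * (flat M1 $ p - flat M0 $ p))"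
  have flat_M: "($) (flat M) = (\<lambda>p. flat M0 $ p + \<tau> * (flat M1 $ p - flat M0 $ p))"
    by (simp add: M_def flat_nth)
  have full: "full_rank M" using \<tau>(2) full_rank_iff_minor[of M] unfolding M_def by blast
  have row: "M $ i = M0 $ i + \<tau> *s (M1 $ i - M0 $ i)" for i
    by (simp add: M_def flat_nth vec_eq_iff algebra_simps)
  have "M $ i \<in> vec.span (\<Union>A)" for i
    unfolding row using M0_sub M1(2) row_in_rowspan[of M0 i] row_in_rowspan[of M1 i]
    by (intro vec.span_add vec.span_scale vec.span_diff) auto
  then have "rowspan M \<subseteq> vec.span (\<Union>A)" by (simp add: rowspan_subset_iff)
  then have "vec.span {flat M} \<in> secant_subspaces (segre_variety X) 0 s"
    by (rule secant_line_of_rowspan_subset[OF X(1) A _ full_rank_nonzero[OF full]])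
  then have "vec.span {flat M} \<in> grassmann_secant (segre_variety X) 0 s"
    using secant_subspaces_subset by (rule subsetD[rotated])
  moreover have "vec.span {flat M} \<notin> D"
    using f \<tau>(1) unfolding D_eq flat_M[symmetric] by blast
  ultimately show ?thesis using full by (intro that)
qed

section \<open>Comparison of general elements\<close>

theorem theorem3p1:
  fixes X :: "('a::{alg_closed_field, field_char_0} ^ 'n) set set"
    and k r s :: nat
  assumes "CARD('n) = r + 1"
    and "CARD('m::finite) = k + 1"
    and "irreducible_proj_variety X"
    and "nondegenerate X"
    and "1 \<le> s"
    and "k \<le> s - 1"
    and "s - 1 < r"
  shows "grassmann_identifiable X k s \<longleftrightarrow>
         identifiable (segre_variety X :: ('a ^ ('m \<times> 'n)) set set) s"
proof -
  let ?S = "segre_variety X :: ('a ^ ('m \<times> 'n)) set set"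
  let ?R = "\<lambda>W. variety_rank X W = s \<and> subspace_identifiable X W"
  let ?R' = "\<lambda>T. variety_rank ?S T = s \<and> subspace_identifiable ?S T"
  have X: "X \<subseteq> proj_space"
    using assms(3) unfolding irreducible_proj_variety_def proj_closed_def by blast
  have s: "s \<le> CARD('n)" "CARD('m) \<le> s" using assms by simp_all
  note secant_iff = secant_iff_full_rank[OF X assms(4) s(1) assms(2)]
  note rank_iff = rank_identifiable_rowspan_iff[OF X]
  show ?thesis
  proof
    assume "grassmann_identifiable X k s"
    then obtain Z where Z: "grassmann_closed k Z" "Z \<subset> grassmann_secant X k s"
      and R: "\<forall>W \<in> grassmann_secant X k s - Z. ?R W"
      unfolding grassmann_identifiable_def by blast
    \<comment> \<open>Every line through a matrix of lower rank lies in \<open>?D\<close>, so a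
      point outside \<open>?D\<close> comes with a matrix of full rank.\<close>
    let ?D = "{T \<in> proj_space. \<forall>M :: 'a ^ 'n ^ 'm. T = vec.span {flat M} \<and> full_rank M \<longrightarrow> rowspan M \<in> Z}"
    let ?Z = "grassmann_secant ?S 0 s \<inter> ?D"
    have "grassmann_closed 0 ?Z"
      by (rule grassmann_closed_Int[OF grassmann_closed_secant closed_pullback_to_tensors[OF assms(2) Z(1)]])
    moreover have "?Z \<subset> grassmann_secant ?S 0 s"
    proof -
      obtain W where W: "W \<in> grassmann_secant X k s" "W \<notin> Z" using Z(2) by blast
      have "W \<in> grassmannian k" using W(1) grassmann_closed_subset[OF grassmann_closed_secant] by blast
      then obtain M :: "'a ^ 'n ^ 'm" where M: "full_rank M" "rowspan M = W"
        by (rule grassmannian_rowspanE[OF assms(2)])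
      have "vec.span {flat M} \<in> grassmann_secant ?S 0 s"
        using secant_iff[OF M(1)] W(1) M(2) by simp
      moreover have "vec.span {flat M} \<notin> ?D" using M W(2) by blast
      ultimately show ?thesis by blast
    qed
    moreover have "?R' T" if T: "T \<in> grassmann_secant ?S 0 s - ?Z" for T
    proof -
      have "T \<in> proj_space" using T grassmann_closed_subset[OF grassmann_closed_secant] by blast
      with T obtain M :: "'a ^ 'n ^ 'm" where M: "T = vec.span {flat M}" "full_rank M" "rowspan M \<notin> Z"
        by blast
      have "rowspan M \<in> grassmann_secant X k s" using secant_iff[OF M(2)] T M(1) by simp
      then have "?R (rowspan M)" using R M(3) by blast
      then show ?thesis unfolding M(1) rank_iff .
    qed
    ultimately show "identifiable ?S s"
      unfolding grassmann_identifiable_def by (intro exI[of _ ?Z]) simp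
  next
    assume "identifiable ?S s"
    then obtain Z where Z: "grassmann_closed 0 Z" "Z \<subset> grassmann_secant ?S 0 s"
      and R: "\<forall>T \<in> grassmann_secant ?S 0 s - Z. ?R' T"
      unfolding grassmann_identifiable_def by blast
    let ?C = "{W \<in> grassmannian k. \<forall>M :: 'a ^ 'n ^ 'm. rowspan M = W \<longrightarrow> vec.span {flat M} \<in> Z}"
    let ?Z = "grassmann_secant X k s \<inter> ?C"
    have "grassmann_closed k ?Z"
      by (rule grassmann_closed_Int[OF grassmann_closed_secant closed_pullback_to_subspaces[OF assms(2) Z(1)]])
    moreover have "?Z \<subset> grassmann_secant X k s"
    proof -
      \<comment> \<open>A proper closed subset misses an actual secant point and not just a limit of
        such points; only there can the tensor be moved to full rank within the span of
        \<open>s\<close> points of \<open>X\<close>.\<close>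
      have "\<not> secant_subspaces ?S 0 s \<subseteq> Z"
        using grassmann_secant_least[OF Z(1)] Z(2) by blast
      then obtain T where T: "T \<in> secant_subspaces ?S 0 s" "T \<notin> Z" by blast
      obtain M :: "'a ^ 'n ^ 'm" where M: "full_rank M" "vec.span {flat M} \<notin> Z"
        "vec.span {flat M} \<in> grassmann_secant ?S 0 s"
        by (rule full_rank_secant_outside_closed[OF X assms(4) s Z(1) T])
      have "rowspan M \<in> grassmann_secant X k s" using secant_iff[OF M(1)] M(3) by simp
      moreover have "rowspan M \<notin> ?C" using M(2) by blast
      ultimately show ?thesis by blast
    qed
    moreover have "?R W" if W: "W \<in> grassmann_secant X k s - ?Z" for W
    proof -
      have gr: "W \<in> grassmannian k" using W grassmann_closed_subset[OF grassmann_closed_secant] by blast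
      \<comment> \<open>Being outside \<open>?C\<close> provides just one suitable matrix with row
        space \<open>W\<close>; that suffices, as rank and identifiability of \<open>W\<close> do
        not refer to the matrix.\<close>
      with W obtain M :: "'a ^ 'n ^ 'm" where M: "rowspan M = W" "vec.span {flat M} \<notin> Z"
        by blast
      have full: "full_rank M" using M(1) gr rowspan_in_grassmannian_iff[OF assms(2)] by blast
      then have "vec.span {flat M} \<in> grassmann_secant ?S 0 s" using secant_iff[OF full] W M(1) by simp
      then have "?R' (vec.span {flat M})" using R M(2) by blast
      then show ?thesis unfolding M(1)[symmetric] rank_iff .
    qed
    ultimately show "grassmann_identifiable X k s"
      unfolding grassmann_identifiable_def by (intro exI[of _ ?Z]) simp
  qed
qed

end
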